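(* Let $\Sigma$ be a complete simplicial fan in $\mathbb{R}^d$ with $n$ rays and let $U\in\mathbb{R}^{n\times d}$ be a ray matrix of $\Sigma$. Then the universal adjoint ${\rm Adj}_{\Sigma,U}$ vanishes on the $(d-1)$-dimensional linear space $\mathbb{P}({\rm im}(U))\subset\mathbb{P}^{n-1}$. In particular, if $\Sigma=\Sigma_P$ is the normal fan of a $d$-dimensional simple polytope $P\subset\mathbb{R}^d$, then $\mathbb{P}({\rm im}(U))\subseteq\mathcal{A}_P$.
   Context: A simplicial fan $\Sigma$ in $\mathbb{R}^d$ is a (finite) polyhedral fan all of whose cones are generated by linearly independent vectors; it is complete if the union of its cones is $\mathbb{R}^d$. $\Sigma(k)$ is the set of $k$-dimensional cones and $\sigma(1)$ the set of rays of a cone $\sigma$; $n=|\Sigma(1)|$. A ray matrix of $\Sigma$ is a matrix $U\in\mathbb{R}^{n\times d}$, assumed of rank $d$, whose rows $u_\rho$ are indexed by $\rho\in\Sigma(1)$, with $u_\rho$ a nonzero generator of the ray $\rho$. For $\sigma\in\Sigma(d)$, $U_\sigma$ is the $d\times d$ submatrix of $U$ with rows indexed by $\sigma(1)$. The universal adjoint is $${\rm Adj}_{\Sigma,U}(x)=\sum_{\sigma\in\Sigma(d)}|\det U_\sigma|\prod_{\rho\in\Sigma(1)\setminus\sigma(1)}x_\rho\ \in\ \mathbb{C}[x_\rho:\rho\in\Sigma(1)].$$ $\mathbb{P}^{n-1}$ is complex projective space with homogeneous coordinates $x_\rho$, $\rho\in\Sigma(1)$, and $\mathbb{P}({\rm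 im}(U))\subset\mathbb{P}^{n-1}$ is the projectivization of the complex column span of $U$. For a full-dimensional simple polytope $P\subset\mathbb{R}^d$ with inner normal fan $\Sigma_P$ and ray matrix $U$ of $\Sigma_P$, $\mathcal{A}_P=\{x\in\mathbb{P}^{n-1}:{\rm Adj}_{\Sigma_P,U}(x)=0\}$. *)

theory Defs
  imports "HOL-Analysis.Analysis" "HOL-Library.Poly_Mapping"
begin

section \<open>Fans\<close>

text \<open>The library's \<^const>\<open>hull\<close> with \<^const>\<open>convex_cone\<close> always contains the origin, so the zero
  cone is generated by the empty set. The empty set counts as a face in the sense of
  \<^const>\<open>face_of\<close> and is excluded below.\<close>

definition polyhedral_cone :: "'a::euclidean_space set \<Rightarrow> bool" where
  "polyhedral_cone C \<longleftrightarrow> (\<exists>S. finite S \<and> C = convex_cone hull S)"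

definition polyhedral_fan :: "'a::euclidean_space set set \<Rightarrow> bool" where
  "polyhedral_fan \<Sigma> \<longleftrightarrow>
     finite \<Sigma> \<and>
     (\<forall>C\<in>\<Sigma>. polyhedral_cone C) \<and>
     (\<forall>C\<in>\<Sigma>. \<forall>F. F face_of C \<and> F \<noteq> {} \<longrightarrow> F \<in> \<Sigma>) \<and>
     (\<forall>C\<in>\<Sigma>. \<forall>D\<in>\<Sigma>. C \<inter> D face_of C \<and> C \<inter> D face_of D)"

definition simplicial_fan :: "'a::euclidean_space set set \<Rightarrow> bool" where
  "simplicial_fan \<Sigma> \<longleftrightarrow>
     polyhedral_fan \<Sigma> \<and> (\<forall>C\<in>\<Sigma>. \<exists>S. independent S \<and> C = convex_cone hull S)"

definition complete_fan :: "'a::euclidean_space set set \<Rightarrow> bool" where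
  "complete_fan \<Sigma> \<longleftrightarrow> \<Union>\<Sigma> = UNIV"

definition fan_cones :: "'a::euclidean_space set set \<Rightarrow> nat \<Rightarrow> 'a set set" where
  "fan_cones \<Sigma> k = {C \<in> \<Sigma>. dim C = k}"

definition cone_rays :: "'a::euclidean_space set \<Rightarrow> 'a set set" where
  "cone_rays C = {R. R face_of C \<and> dim R = 1}"

section \<open>Ray matrices\<close>

text \<open>The \<open>n\<close> rays of the fan are indexed by the finite type \<open>'n\<close>: a ray matrix has a nonzero
  row \<open>U $ i\<close> for each index \<open>i\<close>, and \<open>i \<mapsto> row_ray U i\<close> is the bijection between the indices and
  the rays. Through this bijection the index \<open>i\<close> stands for the ray generated by \<open>U $ i\<close>.\<close>

definition row_ray :: "real^'d^'n \<Rightarrow> 'n \<Rightarrow> (real^'d) set" where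
  "row_ray U i = convex_cone hull {U $ i}"

definition ray_matrix :: "(real^'d) set set \<Rightarrow> real^'d^'n \<Rightarrow> bool" where
  "ray_matrix \<Sigma> U \<longleftrightarrow>
     (\<forall>i. U $ i \<noteq> 0) \<and> bij_betw (row_ray U) UNIV (fan_cones \<Sigma> 1) \<and> rank U = CARD('d)"

definition ray_indices :: "real^'d^'n \<Rightarrow> (real^'d) set \<Rightarrow> 'n set" where
  "ray_indices U C = {i. row_ray U i \<in> cone_rays C}"

text \<open>The rows of \<open>U\<^sub>\<sigma>\<close> carry no preferred order, so they are arranged by an arbitrary bijection with
  the column index type. Only the absolute value of the determinant is used, and it does not
  depend on this choice (see \<open>abs_det_row_order\<close>).\<close>

definition cone_submatrix :: "real^'d^'n \<Rightarrow> (real^'d) set \<Rightarrow> real^'d^'d" where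
  "cone_submatrix U C =
     (let e = (SOME e :: 'd \<Rightarrow> 'n. bij_betw e UNIV (ray_indices U C)) in (\<chi> j. U $ e j))"

lemma abs_det_row_order:
  fixes U :: "real^'d^'n" and e e' :: "'d \<Rightarrow> 'n"
  assumes "bij_betw e UNIV I" "bij_betw e' UNIV I"
  shows "\<bar>det (\<chi> j. U $ e j)\<bar> = \<bar>det (\<chi> j. U $ e' j)\<bar>"
proof -
  define p where "p = inv_into UNIV e' \<circ> e"
  have "bij p"
    unfolding p_def using assms(1) bij_betw_inv_into[OF assms(2)] by (rule bij_betw_trans)
  hence p: "p permutes UNIV" by (simp add: permutes_def bij_iff)
  have "e' (p j) = e j" for j
    using assms by (simp add: p_def bij_betw_def) (metis f_inv_into_f rangeI)
  hence "(\<chi> j. U $ e j) = (\<chi> j. (\<chi> j. U $ e' j) $ p j)" by (simp add: vec_eq_iff)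
  also have "det \<dots> = of_int (sign p) * det (\<chi> j. U $ e' j)"
    by (rule det_permute_rows[OF p])
  finally show ?thesis by (simp add: abs_mult sign_def)
qed

lemma abs_det_cone_submatrix:
  fixes U :: "real^'d^'n" and e :: "'d \<Rightarrow> 'n"
  assumes "bij_betw e UNIV (ray_indices U C)"
  shows "\<bar>det (cone_submatrix U C)\<bar> = \<bar>det (\<chi> j. U $ e j)\<bar>"
  unfolding cone_submatrix_def Let_def
  by (rule abs_det_row_order[OF someI[where P = "\<lambda>e. bij_betw e UNIV (ray_indices U C)", OF assms] assms])

section \<open>The universal adjoint\<close>

text \<open>Polynomials with variables indexed by \<open>'n\<close> are finitely supported maps from exponents to
  coefficients; multiplication of \<^typ>\<open>('n \<Rightarrow>\<^sub>0 nat) \<Rightarrow>\<^sub>0 complex\<close> is the usual convolution.\<close>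

type_synonym 'n cpoly = "('n \<Rightarrow>\<^sub>0 nat) \<Rightarrow>\<^sub>0 complex"

definition pconst :: "complex \<Rightarrow> 'n cpoly" where
  "pconst c = Poly_Mapping.single 0 c"

definition pvar :: "'n \<Rightarrow> 'n cpoly" where
  "pvar i = Poly_Mapping.single (Poly_Mapping.single i 1) 1"

definition peval :: "'n::finite cpoly \<Rightarrow> complex^'n \<Rightarrow> complex" where
  "peval p x = (\<Sum>m\<in>Poly_Mapping.keys p.
     Poly_Mapping.lookup p m * (\<Prod>i\<in>UNIV. (x $ i) ^ Poly_Mapping.lookup m i))"

definition universal_adjoint :: "(real^'d) set set \<Rightarrow> real^'d^'n \<Rightarrow> 'n cpoly" where
  "universal_adjoint \<Sigma> U =
     (\<Sum>C\<in>fan_cones \<Sigma> CARD('d).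
        pconst (complex_of_real \<bar>det (cone_submatrix U C)\<bar>) * (\<Prod>i\<in>UNIV - ray_indices U C. pvar i))"

lemma peval_superset:
  assumes "finite M" "Poly_Mapping.keys p \<subseteq> M"
  shows "peval p x = (\<Sum>m\<in>M. Poly_Mapping.lookup p m * (\<Prod>i\<in>UNIV. (x $ i) ^ Poly_Mapping.lookup m i))"
  unfolding peval_def
  by (rule sum.mono_neutral_left[OF assms]) (auto simp: in_keys_iff)

lemma peval_add: "peval (p + q) x = peval p x + peval q x"
proof -
  let ?M = "Poly_Mapping.keys p \<union> Poly_Mapping.keys q"
  have "finite ?M" "Poly_Mapping.keys (p + q) \<subseteq> ?M" by (auto dest: keys_add[THEN subsetD])
  thus ?thesis
    by (simp add: peval_superset[of ?M] lookup_add distrib_right sum.distrib)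
qed

lemma peval_sum: "peval (\<Sum>a\<in>A. f a) x = (\<Sum>a\<in>A. peval (f a) x)"
proof (induction A rule: infinite_finite_induct)
  case (insert a A)
  thus ?case by (simp add: peval_add)
qed (simp_all add: peval_def)

lemma peval_single: "peval (Poly_Mapping.single m c) x = c * (\<Prod>i\<in>UNIV. (x $ i) ^ Poly_Mapping.lookup m i)"
  by (subst peval_superset[of "{m}"]) auto

lemma prod_pvar:
  assumes "finite I"
  shows "(\<Prod>i\<in>I. pvar i) = Poly_Mapping.single (\<Sum>i\<in>I. Poly_Mapping.single i 1) 1"
  using assms
proof (induction I rule: finite_induct)
  case (insert i I)
  thus ?case by (simp add: pvar_def mult_single)
qed simp

lemma peval_universal_adjoint:
  fixes U :: "real^'d^'n"
  shows "peval (universal_adjoint \<Sigma> U) x =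
     (\<Sum>C\<in>fan_cones \<Sigma> CARD('d).
        complex_of_real \<bar>det (cone_submatrix U C)\<bar> * (\<Prod>i\<in>UNIV - ray_indices U C. x $ i))"
proof -
  have "(\<Prod>i\<in>UNIV. (x $ i) ^ Poly_Mapping.lookup (\<Sum>i\<in>I. Poly_Mapping.single i 1) i) = (\<Prod>i\<in>I. x $ i)"
    for I :: "'n set"
  proof -
    have "Poly_Mapping.lookup (\<Sum>i\<in>I. Poly_Mapping.single i 1) j = (if j \<in> I then 1 else (0::nat))" for j
      by (simp add: lookup_sum lookup_single when_def)
    hence "(\<Prod>j\<in>UNIV. (x $ j) ^ Poly_Mapping.lookup (\<Sum>i\<in>I. Poly_Mapping.single i 1) j) =
        (\<Prod>j\<in>UNIV. if j \<in> I then x $ j else 1)"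
      by (intro prod.cong refl) (simp only: power_one_right power_0 split: if_split, simp)
    thus ?thesis by (simp add: prod.If_cases)
  qed
  thus ?thesis
    by (simp add: universal_adjoint_def peval_sum pconst_def prod_pvar mult_single peval_single)
qed

section \<open>Complex projective space\<close>

text \<open>A point of projective space is a complex line through the origin in \<open>complex^'n\<close>. Complex
  linear algebra uses the library's \<open>vec\<close> interpretation, whose scalar multiplication is \<open>*s\<close>;
  the unqualified \<^const>\<open>span\<close> and \<^const>\<open>dim\<close> are over the reals.\<close>

definition proj_point :: "complex^'n \<Rightarrow> (complex^'n) set" where
  "proj_point x = vec.span {x}"

definition projectivization :: "(complex^'n) set \<Rightarrow> (complex^'n) set set" where
  "projectivization V = proj_point ` (V - {0})"

definition proj_linear_space :: "nat \<Rightarrow> (complex^'n) set set \<Rightarrow> bool" where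
  "proj_linear_space k L \<longleftrightarrow>
     (\<exists>V. vec.subspace V \<and> vec.dim V = k + 1 \<and> L = projectivization V)"

definition vanishes_at :: "'n cpoly \<Rightarrow> (complex^'n) set \<Rightarrow> bool" where
  "vanishes_at p L \<longleftrightarrow> (\<forall>x. x \<noteq> 0 \<and> proj_point x = L \<longrightarrow> peval p x = 0)"

definition complex_image :: "real^'d^'n \<Rightarrow> (complex^'n) set" where
  "complex_image U = vec.span (columns (\<chi> i j. complex_of_real (U $ i $ j)))"

section \<open>Simple polytopes and their adjoint hypersurfaces\<close>

definition simple_polytope :: "'a::euclidean_space set \<Rightarrow> bool" where
  "simple_polytope P \<longleftrightarrow>
     polytope P \<and> (\<forall>v. v extreme_point_of P \<longrightarrow> int (card {F. F facet_of P \<and> v \<in> F}) = aff_dim P)"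

definition inner_normal_cone :: "'a::euclidean_space set \<Rightarrow> 'a set \<Rightarrow> 'a set" where
  "inner_normal_cone P F = {w. \<forall>x\<in>F. \<forall>y\<in>P. w \<bullet> x \<le> w \<bullet> y}"

definition normal_fan :: "'a::euclidean_space set \<Rightarrow> 'a set set" where
  "normal_fan P = {inner_normal_cone P F | F. F face_of P \<and> F \<noteq> {}}"

definition adjoint_hypersurface :: "(real^'d) set \<Rightarrow> real^'d^'n \<Rightarrow> (complex^'n) set set" where
  "adjoint_hypersurface P U =
     {L \<in> projectivization UNIV. vanishes_at (universal_adjoint (normal_fan P) U) L}"

end

theory Submission
  imports Defs
begin

text \<open>Fix \<open>x = U z\<close> and expand an arbitrary vector \<open>v = \<Sum>\<^sub>i a\<^sub>\<sigma>\<^sub>i u\<^sub>i\<close> in the rays of every maximal cone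
  \<open>\<sigma>\<close>. Since \<open>\<langle>v, z\<rangle> = \<Sum>\<^sub>i a\<^sub>\<sigma>\<^sub>i x\<^sub>i\<close>, the product \<open>\<langle>v, z\<rangle> Adj(x)\<close> becomes a sum over the pairs of a
  maximal cone \<open>\<sigma>\<close> and a ray \<open>i\<close> of it, with summands
  \<open>\<bar>det U\<^sub>\<sigma>\<bar> a\<^sub>\<sigma>\<^sub>i \<Prod> x\<^sub>\<rho>\<close>, \<open>\<rho>\<close> ranging over the rays outside the wall \<open>\<sigma>(1) - {i}\<close>. Completeness puts each
  wall in exactly two maximal cones, on opposite sides of it, and by Cramer's rule their
  summands cancel. Hence \<open>\<langle>v, z\<rangle> Adj(x) = 0\<close> for all \<open>v\<close>, and \<open>z \<noteq> 0\<close> gives \<open>Adj(x) = 0\<close>.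
  For a simple polytope the cone of a vertex is generated by the independent normals of the facets
  through it, so the normal fan is simplicial.\<close>

section \<open>Simplicial cones\<close>

lemma convex_cone_hull_image:
  fixes u :: "'i \<Rightarrow> 'a::real_vector"
  assumes "finite I"
  shows "convex_cone hull (u ` I) = {\<Sum>i\<in>I. c i *\<^sub>R u i | c. \<forall>i\<in>I. 0 \<le> c i}" (is "_ = ?K")
proof (rule hull_unique)
  show "u ` I \<subseteq> ?K"
  proof
    fix x assume "x \<in> u ` I"
    then obtain k where k: "k \<in> I" "x = u k" by blast
    have "(\<Sum>i\<in>I. (if i = k then 1 else 0) *\<^sub>R u i) = (\<Sum>i\<in>I. if i = k then u k else 0)"
      by (intro sum.cong) auto
    also have "\<dots> = x" using k assms by simp
    finally have "x = (\<Sum>i\<in>I. (if i = k then 1 else 0) *\<^sub>R u i)" by simp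
    thus "x \<in> ?K" by (intro CollectI exI[of _ "\<lambda>i. if i = k then 1 else 0"]) auto
  qed
  show "convex_cone ?K"
    unfolding convex_cone_iff
  proof (intro conjI ballI allI impI)
    show "0 \<in> ?K" by (intro CollectI exI[of _ "\<lambda>i. 0"]) simp
  next
    fix x y assume "x \<in> ?K" "y \<in> ?K"
    then obtain c d where "\<forall>i\<in>I. 0 \<le> c i" "x = (\<Sum>i\<in>I. c i *\<^sub>R u i)"
      "\<forall>i\<in>I. 0 \<le> d i" "y = (\<Sum>i\<in>I. d i *\<^sub>R u i)" by blast
    thus "x + y \<in> ?K"
      by (intro CollectI exI[of _ "\<lambda>i. c i + d i"]) (simp add: scaleR_left_distrib sum.distrib)
  next
    fix x and e :: real assume "x \<in> ?K" "0 \<le> e"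
    then obtain c where "\<forall>i\<in>I. 0 \<le> c i" "x = (\<Sum>i\<in>I. c i *\<^sub>R u i)" by blast
    thus "e *\<^sub>R x \<in> ?K" using \<open>0 \<le> e\<close>
      by (intro CollectI exI[of _ "\<lambda>i. e * c i"]) (simp add: scaleR_sum_right)
  qed
next
  fix T assume T: "u ` I \<subseteq> T" "convex_cone T"
  have "(\<Sum>i\<in>J. c i *\<^sub>R u i) \<in> T" if "J \<subseteq> I" "\<forall>i\<in>I. 0 \<le> c i" for c J
    using finite_subset[OF that(1) assms] that
  proof (induction J rule: finite_induct)
    case empty
    show ?case using T(2) by (simp add: convex_cone_contains_0)
  next
    case (insert j J)
    thus ?case using T by (auto intro!: convex_cone_add convex_cone_scaleR)
  qed
  thus "?K \<subseteq> T" by blast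
qed

lemma convex_cone_hull_sum_mem:
  fixes u :: "'i \<Rightarrow> 'a::real_vector"
  assumes "finite I" "\<And>i. i \<in> I \<Longrightarrow> 0 \<le> c i"
  shows "(\<Sum>i\<in>I. c i *\<^sub>R u i) \<in> convex_cone hull (u ` I)"
  using assms by (auto simp: convex_cone_hull_image)

lemma convex_cone_hull_sum_obtain:
  fixes u :: "'i \<Rightarrow> 'a::real_vector"
  assumes "finite I" "x \<in> convex_cone hull (u ` I)"
  obtains c where "\<And>i. i \<in> I \<Longrightarrow> 0 \<le> c i" "x = (\<Sum>i\<in>I. c i *\<^sub>R u i)"
  using assms unfolding convex_cone_hull_image[OF assms(1)] by blast

lemma span_convex_cone_hull:
  fixes S :: "'a::real_vector set"
  shows "span (convex_cone hull S) = span S"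
proof (rule span_eq[THEN iffD2], intro conjI)
  show "convex_cone hull S \<subseteq> span S"
    by (rule hull_minimal[where S = convex_cone]) (auto simp: convex_cone_span span_superset)
  show "S \<subseteq> span (convex_cone hull S)"
    by (rule order_trans[OF hull_subset span_superset])
qed

definition indep_family :: "('i \<Rightarrow> 'a::real_vector) \<Rightarrow> 'i set \<Rightarrow> bool" where
  "indep_family u I \<longleftrightarrow> inj_on u I \<and> independent (u ` I)"

lemma indep_family_subset: "indep_family u I \<Longrightarrow> J \<subseteq> I \<Longrightarrow> indep_family u J"
  unfolding indep_family_def by (meson image_mono independent_mono inj_on_subset)

lemma indep_family_sum_eqD:
  assumes "indep_family u I" "finite I"
    and eq: "(\<Sum>i\<in>I. c i *\<^sub>R u i) = (\<Sum>i\<in>I. d i *\<^sub>R u i)" and "k \<in> I"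
  shows "c k = d k"
proof -
  have inj: "inj_on u I" and ind: "independent (u ` I)"
    using assms(1) by (auto simp: indep_family_def)
  define f where "f v = c (the_inv_into I u v) - d (the_inv_into I u v)" for v
  have f: "f (u i) = c i - d i" if "i \<in> I" for i
    using that inj by (simp add: f_def the_inv_into_f_f)
  have "(\<Sum>v\<in>u ` I. f v *\<^sub>R v) = (\<Sum>i\<in>I. (c i - d i) *\<^sub>R u i)"
    using inj by (simp add: sum.reindex f)
  also have "\<dots> = 0" using eq by (simp add: scaleR_left_diff_distrib sum_subtractf)
  finally have "f (u k) = 0"
    using independentD[OF ind, of "u ` I" f "u k"] assms(2,4) by simp
  thus ?thesis using f[OF \<open>k \<in> I\<close>] by simp
qed

lemma indep_family_span_obtain:
  fixes u :: "'i \<Rightarrow> 'a::euclidean_space"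
  assumes "indep_family u I" "finite I" "card I = DIM('a)"
  obtains c where "v = (\<Sum>i\<in>I. c i *\<^sub>R u i)"
proof -
  have "independent (u ` I)" "card (u ` I) = DIM('a)"
    using assms by (auto simp: indep_family_def card_image)
  hence "span (u ` I) = UNIV"
    by (simp add: dim_eq_card_independent flip: dim_eq_full)
  hence "v \<in> span (u ` I)" by simp
  then obtain f where "v = (\<Sum>w\<in>u ` I. f w *\<^sub>R w)"
    unfolding span_finite[OF finite_imageI[OF assms(2)]] by blast
  also have "\<dots> = (\<Sum>i\<in>I. f (u i) *\<^sub>R u i)"
    using assms(1) by (subst sum.reindex) (auto simp: indep_family_def)
  finally show ?thesis by (rule that)
qed

text \<open>Otherwise \<open>u i\<close> has two coordinate vectors over \<open>I\<close>, with
  entries 1 and 0 at \<open>i\<close>.\<close>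

lemma indep_family_not_mem_span:
  assumes "indep_family u I" "finite I" "i \<in> I" "u i = (\<Sum>j\<in>I - {i}. c j *\<^sub>R u j)"
  shows False
proof -
  have "(\<Sum>j\<in>I. (if j = i then 1 else 0) *\<^sub>R u j) = u i"
    using assms(2,3) by (subst sum.remove[of _ i]) auto
  moreover have "(\<Sum>j\<in>I. (if j = i then 0 else c j) *\<^sub>R u j) = u i"
    unfolding assms(4) using assms(2,3) by (subst sum.remove[of _ i]) auto
  ultimately have "(\<Sum>j\<in>I. (if j = i then 1 else 0) *\<^sub>R u j)
      = (\<Sum>j\<in>I. (if j = i then 0 else c j) *\<^sub>R u j)" by simp
  from indep_family_sum_eqD[OF assms(1,2) this assms(3)] show False by simp
qed

lemma dim_convex_cone_hull_indep_family:
  fixes u :: "'i \<Rightarrow> 'a::euclidean_space"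
  assumes "indep_family u I"
  shows "dim (convex_cone hull (u ` I)) = card I"
proof -
  have "dim (convex_cone hull (u ` I)) = dim (u ` I)"
    by (metis dim_span span_convex_cone_hull)
  thus ?thesis using assms by (simp add: indep_family_def dim_eq_card_independent card_image)
qed

text \<open>The sum is the midpoint of \<open>2 *\<^sub>R x\<close> and
  \<open>2 *\<^sub>R y\<close>, so the face takes in \<open>2 *\<^sub>R x\<close> and then, being
  conic, \<open>x\<close>. For \<open>x = y\<close> the open segment is empty, but the sum is
  \<open>2 *\<^sub>R x\<close> itself.\<close>

lemma face_of_convex_cone_addD:
  assumes K: "convex_cone K" and F: "F face_of K" and xy: "x \<in> K" "y \<in> K" "x + y \<in> F"
  shows "x \<in> F"
proof -
  have conF: "conic F" using face_of_conic[OF _ F] K by (simp add: convex_cone_def)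
  have two: "2 *\<^sub>R x \<in> K" "2 *\<^sub>R y \<in> K" using K xy by (auto intro: convex_cone_scaleR)
  have "2 *\<^sub>R x \<in> F"
  proof (cases "x = y")
    case True
    thus ?thesis using xy by (simp add: scaleR_2)
  next
    case False
    have "x + y \<in> open_segment (2 *\<^sub>R x) (2 *\<^sub>R y)"
      using False unfolding in_segment by (intro conjI exI[of _ "1/2"]) auto
    thus ?thesis using face_ofD[OF F] two xy by blast
  qed
  from conicD[OF conF this, of "1/2"] show ?thesis by simp
qed

text \<open>The term of \<open>k\<close> and the remaining sum both lie in the cone, so the face
  contains the former; rescaling turns it into \<open>u k\<close>.\<close>

lemma face_of_convex_cone_hull_generator:
  fixes u :: "'i \<Rightarrow> 'a::euclidean_space"
  assumes fin: "finite I" and F: "F face_of convex_cone hull (u ` I)"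
    and c: "\<And>i. i \<in> I \<Longrightarrow> 0 \<le> c i" and x: "(\<Sum>i\<in>I. c i *\<^sub>R u i) \<in> F" and k: "k \<in> I" "c k > 0"
  shows "u k \<in> F"
proof -
  let ?K = "convex_cone hull (u ` I)"
  have K: "convex_cone ?K" by (rule convex_cone_convex_cone_hull)
  have conF: "conic F" using face_of_conic[OF _ F] K by (simp add: convex_cone_def)
  have "(\<Sum>i\<in>I. c i *\<^sub>R u i) = c k *\<^sub>R u k + (\<Sum>i\<in>I - {k}. c i *\<^sub>R u i)"
    using fin k by (simp add: sum.remove)
  moreover have "c k *\<^sub>R u k \<in> ?K"
    using k by (intro convex_cone_hull_mul hull_inc) auto
  moreover have "(\<Sum>i\<in>I - {k}. c i *\<^sub>R u i) \<in> ?K"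
  proof (rule subsetD[OF hull_mono convex_cone_hull_sum_mem])
    show "u ` (I - {k}) \<subseteq> u ` I" by blast
  qed (use fin c in auto)
  ultimately have "c k *\<^sub>R u k \<in> F"
    using face_of_convex_cone_addD[OF K F, of "c k *\<^sub>R u k" "\<Sum>i\<in>I - {k}. c i *\<^sub>R u i"] x by simp
  from conicD[OF conF this, of "inverse (c k)"] show ?thesis using k by simp
qed

lemma convex_cone_face: "convex_cone K \<Longrightarrow> F face_of K \<Longrightarrow> F \<noteq> {} \<Longrightarrow> convex_cone F"
  for F :: "'a::euclidean_space set"
  unfolding convex_cone_def using face_of_conic face_of_imp_convex by blast

text \<open>The generators lying in \<open>F\<close> suffice: a generator outside \<open>F\<close>
  has coefficient zero in every point of \<open>F\<close>.\<close>

lemma face_of_convex_cone_hull_obtain: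
  fixes u :: "'i \<Rightarrow> 'a::euclidean_space"
  assumes fin: "finite I" and F: "F face_of convex_cone hull (u ` I)" "F \<noteq> {}"
  obtains J where "J \<subseteq> I" "F = convex_cone hull (u ` J)"
proof
  let ?J = "{i\<in>I. u i \<in> F}"
  show "?J \<subseteq> I" by blast
  show "F = convex_cone hull (u ` ?J)"
  proof
    show "convex_cone hull (u ` ?J) \<subseteq> F"
      using convex_cone_face[OF convex_cone_convex_cone_hull F] by (intro hull_minimal) auto
    show "F \<subseteq> convex_cone hull (u ` ?J)"
    proof
      fix x assume "x \<in> F"
      hence "x \<in> convex_cone hull (u ` I)" using F face_of_imp_subset by blast
      then obtain c where c: "\<And>i. i \<in> I \<Longrightarrow> 0 \<le> c i" "x = (\<Sum>i\<in>I. c i *\<^sub>R u i)"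
        using convex_cone_hull_sum_obtain[OF fin] by blast
      have "c i = 0" if "i \<in> I - ?J" for i
      proof -
        have "i \<in> I" "u i \<notin> F" using that by auto
        hence "\<not> c i > 0"
          using face_of_convex_cone_hull_generator[OF fin F(1), of c i] \<open>x \<in> F\<close> c by auto
        thus ?thesis using c(1)[OF \<open>i \<in> I\<close>] by simp
      qed
      hence "x = (\<Sum>i\<in>?J. c i *\<^sub>R u i)"
        unfolding c(2) using fin by (intro sum.mono_neutral_right) auto
      thus "x \<in> convex_cone hull (u ` ?J)"
        using convex_cone_hull_sum_mem[of ?J c u] c(1) fin by auto
    qed
  qed
qed

text \<open>A point with all coefficients positive pulls every generator into the face. This is the
  device by which intersections of cones are identified below.\<close>

lemma face_of_convex_cone_hull_eq:
  fixes u :: "'i \<Rightarrow> 'a::euclidean_space"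
  assumes "finite I" "F face_of convex_cone hull (u ` I)"
    and "\<And>i. i \<in> I \<Longrightarrow> 0 < c i" "(\<Sum>i\<in>I. c i *\<^sub>R u i) \<in> F"
  shows "F = convex_cone hull (u ` I)"
proof
  show "F \<subseteq> convex_cone hull (u ` I)" using assms(2) by (rule face_of_imp_subset)
  have "u ` I \<subseteq> F"
    using face_of_convex_cone_hull_generator[OF assms(1,2) _ assms(4)] assms(3) less_imp_le
    by (metis image_subsetI)
  thus "convex_cone hull (u ` I) \<subseteq> F"
    using convex_cone_face[OF convex_cone_convex_cone_hull assms(2)] assms(4)
    by (intro hull_minimal) auto
qed

text \<open>By uniqueness of coefficients, at an index outside \<open>J\<close> a convex combination
  of the nonnegative coefficients of both endpoints vanishes, hence both do.\<close>

lemma convex_cone_hull_face_of: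
  fixes u :: "'i \<Rightarrow> 'a::euclidean_space"
  assumes ind: "indep_family u I" and fin: "finite I" and J: "J \<subseteq> I"
  shows "convex_cone hull (u ` J) face_of convex_cone hull (u ` I)"
  unfolding face_of_def
proof (intro conjI ballI impI)
  show sub: "convex_cone hull (u ` J) \<subseteq> convex_cone hull (u ` I)" using J by (intro hull_mono) auto
  show "convex (convex_cone hull (u ` J))" by (rule convex_convex_cone_hull)
  fix a b x
  assume a: "a \<in> convex_cone hull (u ` I)" and b: "b \<in> convex_cone hull (u ` I)"
    and x: "x \<in> convex_cone hull (u ` J)" and seg: "x \<in> open_segment a b"
  obtain \<alpha> where \<alpha>: "\<And>i. i \<in> I \<Longrightarrow> 0 \<le> \<alpha> i" "a = (\<Sum>i\<in>I. \<alpha> i *\<^sub>R u i)"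
    using convex_cone_hull_sum_obtain[OF fin a] by blast
  obtain \<beta> where \<beta>: "\<And>i. i \<in> I \<Longrightarrow> 0 \<le> \<beta> i" "b = (\<Sum>i\<in>I. \<beta> i *\<^sub>R u i)"
    using convex_cone_hull_sum_obtain[OF fin b] by blast
  obtain \<gamma> where \<gamma>: "x = (\<Sum>i\<in>J. \<gamma> i *\<^sub>R u i)"
    using convex_cone_hull_sum_obtain[OF finite_subset[OF J fin] x] by blast
  obtain t where t: "0 < t" "t < 1" "x = (1 - t) *\<^sub>R a + t *\<^sub>R b"
    using seg by (auto simp: in_segment)
  have "x = (\<Sum>i\<in>I. ((1 - t) * \<alpha> i + t * \<beta> i) *\<^sub>R u i)"
    by (simp add: t(3) \<alpha>(2) \<beta>(2) scaleR_left_distrib sum.distrib scaleR_sum_right)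
  moreover have "x = (\<Sum>i\<in>I. (if i \<in> J then \<gamma> i else 0) *\<^sub>R u i)"
    unfolding \<gamma> using fin J by (intro sum.mono_neutral_cong_left) auto
  ultimately have eq: "(\<Sum>i\<in>I. ((1 - t) * \<alpha> i + t * \<beta> i) *\<^sub>R u i)
      = (\<Sum>i\<in>I. (if i \<in> J then \<gamma> i else 0) *\<^sub>R u i)" by simp
  have zero: "\<alpha> i = 0 \<and> \<beta> i = 0" if "i \<in> I - J" for i
  proof -
    have "(1 - t) * \<alpha> i + t * \<beta> i = 0"
      using indep_family_sum_eqD[OF ind fin eq, of i] that by simp
    moreover have "0 \<le> (1 - t) * \<alpha> i" "0 \<le> t * \<beta> i" using t \<alpha>(1) \<beta>(1) that by auto
    ultimately have "(1 - t) * \<alpha> i = 0" "t * \<beta> i = 0" by linarith+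
    thus ?thesis using t by simp
  qed
  have "a = (\<Sum>i\<in>J. \<alpha> i *\<^sub>R u i)" "b = (\<Sum>i\<in>J. \<beta> i *\<^sub>R u i)"
    unfolding \<alpha>(2) \<beta>(2) using fin J zero by (auto intro!: sum.mono_neutral_right)
  thus "a \<in> convex_cone hull (u ` J)" "b \<in> convex_cone hull (u ` J)"
    using convex_cone_hull_sum_mem[OF finite_subset[OF J fin], of \<alpha> u]
      convex_cone_hull_sum_mem[OF finite_subset[OF J fin], of \<beta> u] \<alpha>(1) \<beta>(1) J by auto
qed

section \<open>Walls of a complete simplicial fan\<close>

abbreviation row_cone :: "real^'d^'n \<Rightarrow> 'n set \<Rightarrow> (real^'d) set" where
  "row_cone U I \<equiv> convex_cone hull (($) U ` I)"

lemma row_ray_eq: "row_ray U i = row_cone U {i}"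
  by (simp add: row_ray_def)

lemma fan_faceD: "simplicial_fan \<Sigma> \<Longrightarrow> C \<in> \<Sigma> \<Longrightarrow> F face_of C \<Longrightarrow> F \<noteq> {} \<Longrightarrow> F \<in> \<Sigma>"
  by (simp add: simplicial_fan_def polyhedral_fan_def)

lemma fan_Int_face:
  "simplicial_fan \<Sigma> \<Longrightarrow> C \<in> \<Sigma> \<Longrightarrow> D \<in> \<Sigma> \<Longrightarrow> C \<inter> D face_of C \<and> C \<inter> D face_of D"
  by (simp add: simplicial_fan_def polyhedral_fan_def)

text \<open>The independent generators \<open>S\<close> span exactly the rays of \<open>C\<close>,
  and each ray is also spanned by exactly one row. Thus the rows generate the same cone, and a count
  shows that they are distinct and independent.\<close>

lemma simplicial_fan_cone:
  fixes U :: "real^'d^'n"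
  assumes \<Sigma>: "simplicial_fan \<Sigma>" and U: "ray_matrix \<Sigma> U" and C: "C \<in> \<Sigma>"
  shows "indep_family (($) U) (ray_indices U C)" "C = row_cone U (ray_indices U C)"
proof -
  let ?I = "ray_indices U C"
  obtain S where S: "independent S" "C = convex_cone hull S"
    using \<Sigma> C by (auto simp: simplicial_fan_def)
  have finS: "finite S" using S(1) by (rule independent_imp_finite)
  have idS: "indep_family (\<lambda>s. s) S" using S(1) by (simp add: indep_family_def)
  have faces: "convex_cone hull T face_of C" if "T \<subseteq> S" for T
    using convex_cone_hull_face_of[OF idS finS that] by (simp add: S(2))
  have dimT: "dim (convex_cone hull T) = card T" if "T \<subseteq> S" for T
    using dim_convex_cone_hull_indep_family[OF indep_family_subset[OF idS that]] by simp
  \<comment> \<open>A face is generated by some \<open>T \<subseteq> S\<close> and has dimension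
    \<open>card T\<close>, so the rays belong to the singletons.\<close>
  have rays: "cone_rays C = (\<lambda>s. convex_cone hull {s}) ` S"
  proof (intro set_eqI iffI)
    fix R assume "R \<in> cone_rays C"
    hence R: "R face_of C" "dim R = 1" by (auto simp: cone_rays_def)
    hence "R \<noteq> {}" by auto
    then obtain T where T: "T \<subseteq> S" "R = convex_cone hull T"
      using face_of_convex_cone_hull_obtain[OF finS, of R "\<lambda>s. s"] R(1) S(2) by auto
    with R dimT have "card T = 1" by simp
    then obtain s where "T = {s}" by (rule card_1_singletonE)
    thus "R \<in> (\<lambda>s. convex_cone hull {s}) ` S" using T by auto
  next
    fix R assume "R \<in> (\<lambda>s. convex_cone hull {s}) ` S"
    then obtain s where "s \<in> S" "R = convex_cone hull {s}" by blast
    thus "R \<in> cone_rays C" using faces[of "{s}"] dimT[of "{s}"] by (simp add: cone_rays_def)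
  qed
  have bij: "bij_betw (row_ray U) UNIV (fan_cones \<Sigma> 1)"
    using U by (simp add: ray_matrix_def)
  have sub: "cone_rays C \<subseteq> fan_cones \<Sigma> 1"
  proof
    fix R assume "R \<in> cone_rays C"
    hence "R face_of C" "dim R = 1" "R \<noteq> {}" by (auto simp: cone_rays_def)
    thus "R \<in> fan_cones \<Sigma> 1" using fan_faceD[OF \<Sigma> C] by (simp add: fan_cones_def)
  qed
  have img: "row_ray U ` ?I = cone_rays C"
  proof
    show "cone_rays C \<subseteq> row_ray U ` ?I"
    proof
      fix R assume R: "R \<in> cone_rays C"
      hence "R \<in> range (row_ray U)" using sub bij_betw_imp_surj_on[OF bij] by auto
      then obtain i where "R = row_ray U i" by (rule rangeE)
      thus "R \<in> row_ray U ` ?I" using R by (auto simp: ray_indices_def)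
    qed
  qed (auto simp: ray_indices_def)
  have "inj_on (row_ray U) ?I" using bij by (auto simp: bij_betw_def inj_on_def)
  hence "card ?I = card (cone_rays C)" using img card_image by metis
  also have "\<dots> \<le> card S" unfolding rays by (rule card_image_le[OF finS])
  finally have card_le: "card ?I \<le> card S" .
  show eq: "C = row_cone U ?I"
  proof
    have "U $ i \<in> C" if "i \<in> ?I" for i
    proof -
      have "row_ray U i \<subseteq> C"
        using that by (auto simp: ray_indices_def cone_rays_def dest: face_of_imp_subset)
      thus ?thesis unfolding row_ray_def by (auto simp: hull_inc)
    qed
    thus "row_cone U ?I \<subseteq> C"
      unfolding S(2) by (intro hull_minimal convex_cone_convex_cone_hull) auto
    have "s \<in> row_cone U ?I" if "s \<in> S" for s
    proof -
      have "convex_cone hull {s} \<in> row_ray U ` ?I" using that by (simp add: img rays)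
      then obtain i where i: "i \<in> ?I" "row_ray U i = convex_cone hull {s}" by auto
      have "s \<in> row_cone U {i}"
        using i(2) by (metis hull_inc row_ray_eq singletonI)
      thus ?thesis using i(1) hull_mono[of "($) U ` {i}" "($) U ` ?I" convex_cone] by auto
    qed
    thus "C \<subseteq> row_cone U ?I"
      unfolding S(2) by (intro hull_minimal convex_cone_convex_cone_hull) auto
  qed
  \<comment> \<open>At most \<open>card S\<close> indices yield rows spanning a space of dimension
    \<open>card S\<close>; this leaves room for neither a repetition nor a linear relation.\<close>
  have span: "span (($) U ` ?I) = span S"
    by (metis S(2) eq span_convex_cone_hull)
  hence dimS: "dim (span S) = card S" "dim (span S) \<le> card (($) U ` ?I)"
    using S(1) dim_le_card[of "span S" "($) U ` ?I"] by (simp_all add: dim_eq_card_independent)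
  have card_im: "card (($) U ` ?I) \<le> card ?I" by (rule card_image_le) simp
  have "independent (($) U ` ?I)"
    using card_le_dim_spanning[of "($) U ` ?I" "span S"] span dimS card_im card_le
    by (metis finite finite_imageI le_trans order_refl span_superset)
  moreover have "inj_on (($) U) ?I"
    using dimS card_im card_le by (intro eq_card_imp_inj_on) auto
  ultimately show "indep_family (($) U) ?I" by (simp add: indep_family_def)
qed

lemma card_ray_indices:
  assumes "simplicial_fan \<Sigma>" "ray_matrix \<Sigma> U" "C \<in> \<Sigma>"
  shows "card (ray_indices U C) = dim C"
  using dim_convex_cone_hull_indep_family[OF simplicial_fan_cone(1)[OF assms]]
    simplicial_fan_cone(2)[OF assms] by simp

text \<open>A common point in the relative interiors of two cones forces them to coincide.\<close>

lemma same_side_cone_eq: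
  fixes U :: "real^'d^'n"
  assumes \<Sigma>: "simplicial_fan \<Sigma>" and U: "ray_matrix \<Sigma> U" and C: "C \<in> \<Sigma>" and D: "D \<in> \<Sigma>"
    and i: "i \<in> ray_indices U C" and k: "k \<in> ray_indices U D"
    and wall: "ray_indices U C - {i} = ray_indices U D - {k}"
    and side: "U $ k = (\<Sum>j\<in>ray_indices U C - {i}. b j *\<^sub>R U $ j) + \<beta> *\<^sub>R U $ i" "\<beta> > 0"
  shows "C = D"
proof -
  let ?\<tau> = "ray_indices U C - {i}"
  \<comment> \<open>This keeps every \<open>1 + \<epsilon> * b j\<close> positive; the summand 1
    guards against a zero denominator.\<close>
  define \<epsilon> where "\<epsilon> = inverse (1 + (\<Sum>j\<in>?\<tau>. \<bar>b j\<bar>))"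
  have pos: "1 + (\<Sum>j\<in>?\<tau>. \<bar>b j\<bar>) > 0"
    by (intro add_pos_nonneg sum_nonneg) auto
  hence \<epsilon>: "\<epsilon> > 0" by (simp add: \<epsilon>_def)
  have small: "1 + \<epsilon> * b j > 0" if "j \<in> ?\<tau>" for j
  proof -
    have "- b j \<le> \<bar>b j\<bar>" by simp
    also have "\<dots> \<le> (\<Sum>j\<in>?\<tau>. \<bar>b j\<bar>)" using that by (intro member_le_sum) auto
    finally have "0 < 1 + (\<Sum>j\<in>?\<tau>. \<bar>b j\<bar>) + b j" by simp
    hence "0 < \<epsilon> * (1 + (\<Sum>j\<in>?\<tau>. \<bar>b j\<bar>) + b j)" using \<epsilon> by simp
    also have "\<dots> = 1 + \<epsilon> * b j" using pos by (simp add: \<epsilon>_def field_simps)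
    finally show ?thesis .
  qed
  \<comment> \<open>A point of the wall pushed slightly towards \<open>U $ k\<close>. Its
    coefficients are positive in the rows of \<open>D\<close> and, because
    \<open>\<beta> > 0\<close>, also in the rows of \<open>C\<close>, so the face
    \<open>C \<inter> D\<close> is all of both cones.\<close>
  define p where "p = (\<Sum>j\<in>?\<tau>. U $ j) + \<epsilon> *\<^sub>R U $ k"
  have "p = (\<Sum>j\<in>?\<tau>. U $ j) + (\<Sum>j\<in>?\<tau>. (\<epsilon> * b j) *\<^sub>R U $ j) + (\<epsilon> * \<beta>) *\<^sub>R U $ i"
    unfolding p_def side(1) by (simp add: scaleR_right_distrib scaleR_sum_right)
  also have "\<dots> = (\<Sum>j\<in>?\<tau>. (1 + \<epsilon> * b j) *\<^sub>R U $ j) + (\<epsilon> * \<beta>) *\<^sub>R U $ i"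
    by (simp add: scaleR_left_distrib sum.distrib)
  also have "\<dots> = (\<Sum>j\<in>ray_indices U C. (if j = i then \<epsilon> * \<beta> else 1 + \<epsilon> * b j) *\<^sub>R U $ j)"
    using i by (subst (2) sum.remove[of _ i]) (auto simp: add.commute)
  finally have pC: "p = (\<Sum>j\<in>ray_indices U C. (if j = i then \<epsilon> * \<beta> else 1 + \<epsilon> * b j) *\<^sub>R U $ j)" .
  have pD: "p = (\<Sum>j\<in>ray_indices U D. (if j = k then \<epsilon> else 1) *\<^sub>R U $ j)"
    unfolding p_def wall using k by (subst (2) sum.remove[of _ k]) (auto simp: add.commute)
  have "p \<in> C"
    by (subst simplicial_fan_cone(2)[OF \<Sigma> U C], subst pC, rule convex_cone_hull_sum_mem)
      (use \<epsilon> side(2) small in \<open>auto simp: less_imp_le\<close>)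
  moreover have "p \<in> D"
    by (subst simplicial_fan_cone(2)[OF \<Sigma> U D], subst pD, rule convex_cone_hull_sum_mem)
      (use \<epsilon> in auto)
  ultimately have p: "p \<in> C \<inter> D" by blast
  have "C \<inter> D = row_cone U (ray_indices U C)"
    using fan_Int_face[OF \<Sigma> C D] p simplicial_fan_cone(2)[OF \<Sigma> U C] small \<epsilon> side(2)
    by (intro face_of_convex_cone_hull_eq[where c = "\<lambda>j. if j = i then \<epsilon> * \<beta> else 1 + \<epsilon> * b j"])
      (auto simp flip: pC)
  moreover have "C \<inter> D = row_cone U (ray_indices U D)"
    using fan_Int_face[OF \<Sigma> C D] p simplicial_fan_cone(2)[OF \<Sigma> U D] \<epsilon>
    by (intro face_of_convex_cone_hull_eq[where c = "\<lambda>j. if j = k then \<epsilon> else 1"])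
      (auto simp flip: pD)
  ultimately show ?thesis
    using simplicial_fan_cone(2)[OF \<Sigma> U C] simplicial_fan_cone(2)[OF \<Sigma> U D] by simp
qed

text \<open>Points approaching the middle \<open>p\<close> of the wall from the side away from
  \<open>U $ i\<close> fall infinitely often into one cone \<open>D\<close>, as the fan is finite
  and complete. Since \<open>D\<close> is closed it contains \<open>p\<close>, hence the whole wall,
  and the approaching points force one more row of \<open>D\<close>, on the far side.\<close>

lemma opposite_cone_exists:
  fixes U :: "real^'d^'n"
  assumes \<Sigma>: "simplicial_fan \<Sigma>" and compl: "complete_fan \<Sigma>" and U: "ray_matrix \<Sigma> U"
    and C: "C \<in> fan_cones \<Sigma> CARD('d)" and i: "i \<in> ray_indices U C"
  obtains D k b \<beta> where "D \<in> fan_cones \<Sigma> CARD('d)" "k \<in> ray_indices U D" "D \<noteq> C"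
    "ray_indices U C - {i} = ray_indices U D - {k}"
    "U $ i = (\<Sum>j\<in>ray_indices U C - {i}. b j *\<^sub>R U $ j) + \<beta> *\<^sub>R U $ k" "\<beta> < 0"
proof -
  have C\<Sigma>: "C \<in> \<Sigma>" and dimC: "dim C = CARD('d)" using C by (auto simp: fan_cones_def)
  let ?\<tau> = "ray_indices U C - {i}"
  define p where "p = (\<Sum>j\<in>?\<tau>. 1 *\<^sub>R U $ j)"
  define q where "q m = p - inverse (real (Suc m)) *\<^sub>R U $ i" for m
  have "\<exists>D\<in>\<Sigma>. q m \<in> D" for m using compl by (auto simp: complete_fan_def)
  moreover have fin: "finite \<Sigma>" using \<Sigma> by (simp add: simplicial_fan_def polyhedral_fan_def)
  ultimately obtain D where D: "D \<in> \<Sigma>" and inf: "infinite {m\<in>UNIV. q m \<in> D}"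
    using pigeonhole_infinite_rel[of "UNIV :: nat set" \<Sigma> "\<lambda>m D. q m \<in> D"] by auto
  note Ceq = simplicial_fan_cone[OF \<Sigma> U C\<Sigma>] and Deq = simplicial_fan_cone[OF \<Sigma> U D]
  have "q \<longlonglongrightarrow> p - 0 *\<^sub>R U $ i"
    unfolding q_def by (intro tendsto_intros LIMSEQ_inverse_real_of_nat)
  hence lim: "q \<longlonglongrightarrow> p" by simp
  have "closed D" by (subst Deq(2)) (rule closed_convex_cone_hull, simp)
  \<comment> \<open>The subsequence of those \<open>q m\<close> that lie in \<open>D\<close> still
    converges to \<open>p\<close>.\<close>
  hence pD: "p \<in> D"
  proof (rule closed_sequentially)
    show "q (enumerate {m. q m \<in> D} n) \<in> D" for n
      using enumerate_in_set[of "{m. q m \<in> D}" n] inf by simp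
    show "(\<lambda>n. q (enumerate {m. q m \<in> D} n)) \<longlonglongrightarrow> p"
      using LIMSEQ_subseq_LIMSEQ[OF lim strict_mono_enumerate] inf by (simp add: o_def)
  qed
  let ?T = "row_cone U ?\<tau>"
  have T: "?T face_of C"
    using convex_cone_hull_face_of[OF Ceq(1), of ?\<tau>] Ceq(2) by auto
  hence T\<Sigma>: "?T \<in> \<Sigma>" by (intro fan_faceD[OF \<Sigma> C\<Sigma>]) (auto simp: convex_cone_hull_nonempty)
  have pT: "p \<in> ?T" unfolding p_def by (rule convex_cone_hull_sum_mem) auto
  \<comment> \<open>All coefficients of \<open>p\<close> in the wall cone \<open>?T\<close> equal 1,
    so a face of \<open>?T\<close> through \<open>p\<close> is all of \<open>?T\<close>.\<close>
  have "?T \<inter> D = ?T"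
    using fan_Int_face[OF \<Sigma> T\<Sigma> D] pD pT
    by (intro face_of_convex_cone_hull_eq[where c = "\<lambda>j. 1"]) (auto simp: p_def)
  hence TD: "?T face_of D" using fan_Int_face[OF \<Sigma> T\<Sigma> D] by simp
  have \<tau>D: "?\<tau> \<subseteq> ray_indices U D"
  proof
    fix j assume j: "j \<in> ?\<tau>"
    have ind: "indep_family (($) U) ?\<tau>" by (rule indep_family_subset[OF Ceq(1)]) auto
    have "row_ray U j face_of ?T"
      unfolding row_ray_eq using convex_cone_hull_face_of[OF ind, of "{j}"] j by simp
    hence "row_ray U j face_of D" using TD face_of_trans by blast
    moreover have "dim (row_ray U j) = 1"
      unfolding row_ray_eq using dim_convex_cone_hull_indep_family[OF indep_family_subset[OF ind, of "{j}"]] j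
      by simp
    ultimately show "j \<in> ray_indices U D" by (simp add: ray_indices_def cone_rays_def)
  qed
  \<comment> \<open>One such point now suffices: the definition of \<open>q m\<close> is solved for
    \<open>U $ i\<close>, and \<open>q m\<close> is expanded in the rows of
    \<open>D\<close>.\<close>
  obtain m where m: "q m \<in> D"
    using inf not_finite_existsD by auto
  define \<epsilon> where "\<epsilon> = inverse (real (Suc m))"
  have \<epsilon>: "\<epsilon> > 0" by (simp add: \<epsilon>_def)
  obtain c where c: "\<And>j. j \<in> ray_indices U D \<Longrightarrow> 0 \<le> c j" "q m = (\<Sum>j\<in>ray_indices U D. c j *\<^sub>R U $ j)"
    using convex_cone_hull_sum_obtain[of "ray_indices U D" "q m" "($) U"] m Deq(2) by auto
  have Ui: "U $ i = inverse \<epsilon> *\<^sub>R (p - q m)"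
    using \<epsilon> by (simp add: q_def \<epsilon>_def)
  have indep: False if "U $ i = (\<Sum>j\<in>?\<tau>. f j *\<^sub>R U $ j)" for f
    using indep_family_not_mem_span[OF Ceq(1) _ i that] by simp
  \<comment> \<open>Without a further row, \<open>U $ i\<close> would depend on the wall
    rows.\<close>
  have "ray_indices U D \<noteq> ?\<tau>"
  proof
    assume eq: "ray_indices U D = ?\<tau>"
    have "U $ i = (\<Sum>j\<in>?\<tau>. (inverse \<epsilon> * (1 - c j)) *\<^sub>R U $ j)"
      unfolding Ui p_def c(2) eq
      by (simp add: scaleR_sum_right scaleR_left_diff_distrib scaleR_right_diff_distrib
          right_diff_distrib sum_subtractf)
    thus False by (rule indep)
  qed
  with \<tau>D obtain k where k: "k \<in> ray_indices U D" "k \<notin> ?\<tau>" by blast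
  \<comment> \<open>The wall together with \<open>k\<close> already has \<open>CARD('d)\<close>
    indices, the maximum for a cone, so it exhausts the indices of \<open>D\<close>.\<close>
  have "card (ray_indices U D) = dim D" "card (ray_indices U C) = CARD('d)"
    using card_ray_indices[OF \<Sigma> U] C\<Sigma> D dimC by auto
  moreover have "dim D \<le> CARD('d)" using dim_subset_UNIV_cart by blast
  moreover have "card (insert k ?\<tau>) = card (ray_indices U C)"
    using k(2) i by (simp add: card_gt_0_iff)
      (metis Suc_pred card_gt_0_iff empty_iff finite)
  moreover have sub: "insert k ?\<tau> \<subseteq> ray_indices U D" using k \<tau>D by blast
  ultimately have dimD: "dim D = CARD('d)" and card: "card (ray_indices U D) \<le> card (insert k ?\<tau>)"
    using card_mono[OF finite sub] by linarith+
  have ID: "insert k ?\<tau> = ray_indices U D" by (rule card_seteq[OF finite sub card])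
  have wall: "?\<tau> = ray_indices U D - {k}" using ID k(2) by blast
  have qm: "q m = c k *\<^sub>R U $ k + (\<Sum>j\<in>?\<tau>. c j *\<^sub>R U $ j)"
    unfolding c(2) wall using k(1) by (simp add: sum.remove)
  have eq: "U $ i = (\<Sum>j\<in>?\<tau>. (inverse \<epsilon> * (1 - c j)) *\<^sub>R U $ j) + (- (inverse \<epsilon> * c k)) *\<^sub>R U $ k"
    unfolding Ui p_def qm
    by (simp add: scaleR_sum_right scaleR_left_diff_distrib scaleR_right_diff_distrib
          scaleR_right_distrib right_diff_distrib sum_subtractf)
  have "c k \<noteq> 0"
  proof
    assume "c k = 0"
    with eq have "U $ i = (\<Sum>j\<in>?\<tau>. (inverse \<epsilon> * (1 - c j)) *\<^sub>R U $ j)"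
      by (simp only: mult_zero_right neg_0_equal_iff_equal minus_zero scaleR_zero_left add_0_right)
    thus False by (rule indep)
  qed
  with c(1)[OF k(1)] \<epsilon> have neg: "- (inverse \<epsilon> * c k) < 0" by simp
  \<comment> \<open>Equality would give \<open>k = i\<close> and two expansions of
    \<open>U $ i\<close>, with coefficient 1 and a negative coefficient at \<open>i\<close>.\<close>
  have "D \<noteq> C"
  proof
    assume "D = C"
    hence "k = i" using k by auto
    have "(\<Sum>j\<in>ray_indices U C. (if j = i then 1 else 0) *\<^sub>R U $ j) = U $ i"
      using i by (subst sum.remove[of _ i]) auto
    moreover have "(\<Sum>j\<in>ray_indices U C. (if j = i then - (inverse \<epsilon> * c k) else inverse \<epsilon> * (1 - c j)) *\<^sub>R U $ j) = U $ i"
      using i by (subst eq, subst sum.remove[of _ i]) (auto simp: \<open>k = i\<close> add.commute)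
    ultimately have "(\<Sum>j\<in>ray_indices U C. (if j = i then 1 else 0) *\<^sub>R U $ j)
      = (\<Sum>j\<in>ray_indices U C. (if j = i then - (inverse \<epsilon> * c k) else inverse \<epsilon> * (1 - c j)) *\<^sub>R U $ j)"
      by simp
    from indep_family_sum_eqD[OF Ceq(1) _ this i] neg show False by simp
  qed
  moreover have "D \<in> fan_cones \<Sigma> CARD('d)" using D dimD by (simp add: fan_cones_def)
  ultimately show ?thesis by (intro that[OF _ k(1) _ wall eq neg])
qed

section \<open>Cancellation across walls\<close>

text \<open>With matching orders of rows the two submatrices differ in one row. By Cramer's rule,
  replacing the row \<open>U $ i\<close> by a combination of all rows multiplies the determinant by
  its coefficient \<open>\<beta>\<close>.\<close>

lemma wall_crossing_det:
  fixes U :: "real^'d^'n"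
  assumes card: "card (ray_indices U C) = CARD('d)"
    and i: "i \<in> ray_indices U C" and k: "k \<in> ray_indices U D"
    and wall: "ray_indices U C - {i} = ray_indices U D - {k}"
    and eq: "U $ k = (\<Sum>j\<in>ray_indices U C - {i}. b j *\<^sub>R U $ j) + \<beta> *\<^sub>R U $ i"
  shows "\<bar>det (cone_submatrix U D)\<bar> = \<bar>\<beta>\<bar> * \<bar>det (cone_submatrix U C)\<bar>"
proof -
  obtain e :: "'d \<Rightarrow> 'n" where e: "bij_betw e UNIV (ray_indices U C)"
    using card finite_same_card_bij[of "UNIV :: 'd set" "ray_indices U C"] by auto
  obtain r where r: "e r = i" using e i by (metis bij_betw_def imageE)
  have inj: "e j = i \<longleftrightarrow> j = r" for j using e r by (auto simp: bij_betw_def inj_def)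
  \<comment> \<open>An order of the rows of \<open>D\<close> that agrees with \<open>e\<close> on
    the wall.\<close>
  define e' where "e' = e(r := k)"
  have "bij_betw e (UNIV - {r}) (ray_indices U C - {i})"
    using bij_betw_DiffI[OF e, of "{r}" "{i}"] r i by (simp add: bij_betw_def)
  hence "bij_betw e' (UNIV - {r}) (ray_indices U C - {i})"
    by (rule bij_betw_cong[THEN iffD1, rotated]) (simp add: e'_def)
  moreover have "bij_betw e' {r} {k}" by (simp add: e'_def)
  moreover have "(ray_indices U C - {i}) \<inter> {k} = {}" using wall by blast
  ultimately have "bij_betw e' (UNIV - {r} \<union> {r}) (ray_indices U C - {i} \<union> {k})"
    by (rule bij_betw_combine)
  moreover have "ray_indices U C - {i} \<union> {k} = ray_indices U D" using wall k by blast
  ultimately have e': "bij_betw e' UNIV (ray_indices U D)" by simp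
  let ?A = "(\<chi> j. U $ e j) :: real^'d^'d"
  let ?x = "(\<chi> j. if j = r then \<beta> else b (e j)) :: real^'d"
  have row: "row j ?A = U $ e j" for j by (simp add: row_def vec_eq_iff)
  have "(\<Sum>j\<in>UNIV. ?x $ j *s row j ?A) = (\<Sum>j\<in>UNIV. (if e j = i then \<beta> else b (e j)) *\<^sub>R U $ e j)"
    by (intro sum.cong) (auto simp: row inj scalar_mult_eq_scaleR)
  also have "\<dots> = (\<Sum>j\<in>ray_indices U C. (if j = i then \<beta> else b j) *\<^sub>R U $ j)"
    by (rule sum.reindex_bij_betw[OF e])
  also have "\<dots> = U $ k"
    unfolding eq using i by (subst sum.remove[of _ i]) (auto simp: add.commute)
  finally have "(\<chi> j. if j = r then \<Sum>j\<in>UNIV. ?x $ j *s row j ?A else row j ?A) = (\<chi> j. U $ e' j)"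
    by (simp add: vec_eq_iff row e'_def)
  hence "det (\<chi> j. U $ e' j) = \<beta> * det ?A"
    using cramer_lemma_transpose[of r ?x ?A] by simp
  thus ?thesis
    by (simp add: abs_det_cone_submatrix[OF e] abs_det_cone_submatrix[OF e'] abs_mult)
qed

section \<open>Pairing the two sides of each wall\<close>

lemma sum_involution_cancel:
  fixes g :: "'b \<Rightarrow> complex"
  assumes "\<And>p. p \<in> S \<Longrightarrow> f p \<in> S" "\<And>p. p \<in> S \<Longrightarrow> f (f p) = p" "\<And>p. p \<in> S \<Longrightarrow> g (f p) = - g p"
  shows "sum g S = 0"
proof -
  have "sum g S = (\<Sum>p\<in>S. g (f p))"
    by (rule sum.reindex_bij_witness[of _ f f]) (use assms in auto)
  also have "\<dots> = - sum g S" using assms(3) by (simp add: sum_negf)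
  finally show ?thesis by simp
qed

text \<open>For uniqueness, the extra row \<open>U $ l\<close> of a second candidate
  \<open>E\<close> is expanded in the rows of \<open>D\<close>. The sign of its coefficient at
  \<open>k\<close> decides: positive gives \<open>E = D\<close>, negative gives the excluded
  \<open>E = C\<close>, and zero makes the rows of \<open>E\<close> dependent.\<close>

lemma wall_partner:
  fixes U :: "real^'d^'n"
  assumes \<Sigma>: "simplicial_fan \<Sigma>" and compl: "complete_fan \<Sigma>" and U: "ray_matrix \<Sigma> U"
    and C: "C \<in> fan_cones \<Sigma> CARD('d)" and i: "i \<in> ray_indices U C"
  shows "\<exists>!(D, k). D \<in> fan_cones \<Sigma> CARD('d) \<and> k \<in> ray_indices U D \<and>
     ray_indices U C - {i} = ray_indices U D - {k} \<and> D \<noteq> C" (is "\<exists>!(D, k). ?Q D k")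
proof -
  have C\<Sigma>: "C \<in> \<Sigma>" using C by (simp add: fan_cones_def)
  note Cf = simplicial_fan_cone[OF \<Sigma> U C\<Sigma>]
  obtain D k b \<beta> where D: "D \<in> fan_cones \<Sigma> CARD('d)" "k \<in> ray_indices U D" "D \<noteq> C"
    "ray_indices U C - {i} = ray_indices U D - {k}"
    "U $ i = (\<Sum>j\<in>ray_indices U C - {i}. b j *\<^sub>R U $ j) + \<beta> *\<^sub>R U $ k" "\<beta> < 0"
    by (rule opposite_cone_exists[OF \<Sigma> compl U C i])
  have D\<Sigma>: "D \<in> \<Sigma>" using D(1) by (simp add: fan_cones_def)
  have Q: "?Q D k" using D by simp
  have uniq: "E = D \<and> l = k" if E: "?Q E l" for E l
  proof -
    have E\<Sigma>: "E \<in> \<Sigma>" and dimE: "dim E = CARD('d)" using E by (auto simp: fan_cones_def)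
    have wallD: "ray_indices U D - {k} = ray_indices U C - {i}" using D(4) by simp
    have wallE: "ray_indices U E - {l} = ray_indices U C - {i}" using E by simp
    have cardD: "card (ray_indices U D) = DIM(real^'d)"
      using card_ray_indices[OF \<Sigma> U D\<Sigma>] D(1) by (simp add: fan_cones_def)
    obtain a where a: "U $ l = (\<Sum>j\<in>ray_indices U D. a j *\<^sub>R U $ j)"
      using indep_family_span_obtain[OF simplicial_fan_cone(1)[OF \<Sigma> U D\<Sigma>] _ cardD] by auto
    have l: "U $ l = (\<Sum>j\<in>ray_indices U C - {i}. a j *\<^sub>R U $ j) + a k *\<^sub>R U $ k"
      unfolding a wallD[symmetric] using D(2) by (subst sum.remove[of _ k]) (auto simp: add.commute)
    have "E = D"
    proof (cases "a k > 0")
      case True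
      show ?thesis
        using same_side_cone_eq[OF \<Sigma> U D\<Sigma> E\<Sigma> D(2) _ _ l[folded wallD] True] E wallD by simp
    next
      case False
      \<comment> \<open>Then \<open>U $ l\<close> lies on the side of \<open>U $ i\<close>, or on the wall itself.\<close>
      have "U $ k = inverse \<beta> *\<^sub>R (U $ i - (\<Sum>j\<in>ray_indices U C - {i}. b j *\<^sub>R U $ j))"
        unfolding D(5) using D(6) by simp
      hence l': "U $ l = (\<Sum>j\<in>ray_indices U C - {i}. (a j - a k * inverse \<beta> * b j) *\<^sub>R U $ j)
          + (a k * inverse \<beta>) *\<^sub>R U $ i"
        unfolding l by (simp add: scaleR_left_diff_distrib scaleR_right_diff_distrib
            sum_subtractf scaleR_sum_right mult.assoc)
      show ?thesis
      proof (cases "a k = 0")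
        case True
        hence "U $ l = (\<Sum>j\<in>ray_indices U E - {l}. a j *\<^sub>R U $ j)" using l wallE by simp
        thus ?thesis
          using indep_family_not_mem_span[OF simplicial_fan_cone(1)[OF \<Sigma> U E\<Sigma>], of l a] E by simp
      next
        case nz: False
        hence "a k * inverse \<beta> > 0" using False D(6) by (simp add: mult_neg_neg)
        hence "C = E"
          using same_side_cone_eq[OF \<Sigma> U C\<Sigma> E\<Sigma> i _ _ l'] E by simp
        thus ?thesis using E by simp
      qed
    qed
    \<comment> \<open>Both \<open>l\<close> and \<open>k\<close> are the only index of this one cone
      off the wall.\<close>
    have "l \<in> ray_indices U D" "l \<notin> ray_indices U D - {k}"
      using E wallD wallE \<open>E = D\<close> by simp_all
    thus ?thesis using \<open>E = D\<close> by simp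
  qed
  have "q = (D, k)" if "case q of (E, l) \<Rightarrow> ?Q E l" for q
    using uniq[of "fst q" "snd q"] that by (simp add: split_beta prod_eq_iff)
  thus ?thesis by (intro ex1I[of _ "(D, k)"]) (use Q in simp)
qed

text \<open>A real-linear \<open>L\<close> with complex values transports expansions in the real
  rows to the complex point with coordinates \<open>L (U $ i)\<close>. The vector \<open>v\<close>
  is left free, to be chosen later with \<open>L v \<noteq> 0\<close>.\<close>

lemma linear_functional_times_adjoint:
  fixes U :: "real^'d^'n" and L :: "real^'d \<Rightarrow> complex"
  assumes \<Sigma>: "simplicial_fan \<Sigma>" and compl: "complete_fan \<Sigma>" and U: "ray_matrix \<Sigma> U"
    and L: "linear L"
  shows "L v * peval (universal_adjoint \<Sigma> U) (\<chi> i. L (U $ i)) = 0"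
proof -
  let ?M = "fan_cones \<Sigma> CARD('d)"
  let ?I = "ray_indices U"
  define w where "w C = \<bar>det (cone_submatrix U C)\<bar>" for C
  have cardI: "card (?I C) = CARD('d)" if "C \<in> ?M" for C
    using card_ray_indices[OF \<Sigma> U] that by (simp add: fan_cones_def)
  have ind: "indep_family (($) U) (?I C)" if "C \<in> ?M" for C
    using simplicial_fan_cone(1)[OF \<Sigma> U] that by (simp add: fan_cones_def)
  have "\<exists>a. v = (\<Sum>i\<in>?I C. a i *\<^sub>R U $ i)" if "C \<in> ?M" for C
    using indep_family_span_obtain[OF ind[OF that], of v] cardI[OF that] by auto
  hence "\<exists>a. \<forall>C\<in>?M. v = (\<Sum>i\<in>?I C. a C i *\<^sub>R U $ i)" by (intro bchoice ballI)
  then obtain a where a: "\<And>C. C \<in> ?M \<Longrightarrow> v = (\<Sum>i\<in>?I C. a C i *\<^sub>R U $ i)" by blast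
  \<comment> \<open>A pair of a maximal cone and a ray of it encodes a wall with a chosen side;
    \<open>Q\<close> relates the two sides of a wall, \<open>S\<close> collects all pairs, and
    \<open>f\<close> switches sides.\<close>
  define Q where "Q = (\<lambda>(C, i) (D, k). D \<in> ?M \<and> k \<in> ?I D \<and> ?I C - {i} = ?I D - {k} \<and> D \<noteq> C)"
  define S where "S = (SIGMA C:?M. ?I C)"
  define f where "f p = (THE q. Q p q)" for p
  have ex1: "\<exists>!q. Q p q" if "p \<in> S" for p
  proof -
    obtain C i where p: "p = (C, i)" by (cases p)
    have "C \<in> ?M" "i \<in> ?I C" using that by (auto simp: S_def p)
    from wall_partner[OF \<Sigma> compl U this] show ?thesis by (simp add: Q_def p)
  qed
  have Qf: "Q p (f p)" if "p \<in> S" for p unfolding f_def by (rule theI'[OF ex1[OF that]])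
  have feq: "f p = q" if "p \<in> S" "Q p q" for p q
    unfolding f_def by (rule the1_equality[OF ex1[OF that(1)] that(2)])
  have Qsym: "Q q p" if "p \<in> S" "Q p q" for p q
    using that by (auto simp: S_def Q_def split: prod.splits)
  have QS: "q \<in> S" if "Q p q" for p q using that by (auto simp: S_def Q_def split: prod.splits)
  \<comment> \<open>The product depends on the wall only, so the two sides differ just in the factor
    \<open>w C * a C i\<close>.\<close>
  define g where "g = (\<lambda>(C, i). of_real (w C * a C i) * (\<Prod>j\<in>UNIV - (?I C - {i}). L (U $ j)))"
  have anti: "g q = - g p" if p: "p \<in> S" and Qpq: "Q p q" for p q
  proof -
    obtain C i D k where pq: "p = (C, i)" "q = (D, k)" by (cases p, cases q)
    have C: "C \<in> ?M" "i \<in> ?I C" using p by (auto simp: S_def pq)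
    have D: "D \<in> ?M" "k \<in> ?I D" "?I C - {i} = ?I D - {k}" "D \<noteq> C"
      using Qpq by (auto simp: Q_def pq)
    \<comment> \<open>The partner is unique, so \<open>q\<close> is the cone found by
      \<open>opposite_cone_exists\<close>, which provides the relation between \<open>U $ i\<close>
      and \<open>U $ k\<close> with its negative coefficient.\<close>
    obtain D' k' b \<beta> where D': "D' \<in> ?M" "k' \<in> ?I D'" "D' \<noteq> C" "?I C - {i} = ?I D' - {k'}"
      "U $ i = (\<Sum>j\<in>?I C - {i}. b j *\<^sub>R U $ j) + \<beta> *\<^sub>R U $ k'" "\<beta> < 0"
      by (rule opposite_cone_exists[OF \<Sigma> compl U C])
    have "Q p (D', k')" using D' by (simp add: Q_def pq)
    hence "(D', k') = q" using feq[OF p] Qpq by metis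
    hence "k' = k" by (simp add: pq)
    note Ui = D'(5)[unfolded this]
    have "w C = \<bar>\<beta>\<bar> * w D"
      unfolding w_def by (rule wall_crossing_det[OF cardI[OF D(1)] D(2) C(2) D(3)[symmetric] Ui[unfolded D(3)]])
    hence wC: "w C = - \<beta> * w D" using D'(6) by simp
    \<comment> \<open>Substituting for \<open>U $ i\<close> expresses \<open>v\<close> in the rows
      of \<open>D\<close>; comparison at \<open>k\<close> gives
      \<open>a D k = a C i * \<beta>\<close>, which combines with
      \<open>w C = - \<beta> * w D\<close> to opposite summands.\<close>
    have "v = (\<Sum>j\<in>?I C - {i}. a C j *\<^sub>R U $ j) + a C i *\<^sub>R U $ i"
      using a[OF C(1)] C(2) by (simp add: sum.remove[of "?I C" i] add.commute)
    also have "\<dots> = (\<Sum>j\<in>?I D - {k}. (a C j + a C i * b j) *\<^sub>R U $ j) + (a C i * \<beta>) *\<^sub>R U $ k"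
      by (subst Ui) (simp add: D(3) scaleR_left_distrib scaleR_right_distrib sum.distrib scaleR_sum_right)
    also have "\<dots> = (\<Sum>j\<in>?I D. (if j = k then a C i * \<beta> else a C j + a C i * b j) *\<^sub>R U $ j)"
      using D(2) by (subst (2) sum.remove[of _ k]) (auto simp: add.commute)
    finally have "(\<Sum>j\<in>?I D. a D j *\<^sub>R U $ j)
        = (\<Sum>j\<in>?I D. (if j = k then a C i * \<beta> else a C j + a C i * b j) *\<^sub>R U $ j)"
      using a[OF D(1)] by simp
    from indep_family_sum_eqD[OF ind[OF D(1)] _ this D(2)] have "a D k = a C i * \<beta>" by simp
    hence "w D * a D k = - (w C * a C i)" by (simp add: wC)
    hence "of_real (w D * a D k) = - (of_real (w C * a C i) :: complex)"
      by (simp only: of_real_minus)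
    thus ?thesis by (simp add: g_def pq D(3) del: of_real_mult)
  qed
  have summand: "L v * (of_real (w C) * (\<Prod>j\<in>UNIV - ?I C. L (U $ j))) = (\<Sum>i\<in>?I C. g (C, i))"
    if C: "C \<in> ?M" for C
  proof -
    have "L v = (\<Sum>i\<in>?I C. of_real (a C i) * L (U $ i))"
      by (subst a[OF C]) (simp add: linear_sum[OF L] linear_scale[OF L] flip: scaleR_conv_of_real)
    moreover have "(\<Prod>j\<in>UNIV - (?I C - {i}). L (U $ j)) = L (U $ i) * (\<Prod>j\<in>UNIV - ?I C. L (U $ j))"
      if "i \<in> ?I C" for i
    proof -
      have "UNIV - (?I C - {i}) = insert i (UNIV - ?I C)" using that by blast
      thus ?thesis using that by simp
    qed
    ultimately show ?thesis
      by (simp add: g_def sum_distrib_right sum_distrib_left mult_ac)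
  qed
  have finM: "finite ?M"
    using \<Sigma> by (simp add: fan_cones_def simplicial_fan_def polyhedral_fan_def)
  have "L v * peval (universal_adjoint \<Sigma> U) (\<chi> i. L (U $ i))
      = (\<Sum>C\<in>?M. L v * (of_real (w C) * (\<Prod>j\<in>UNIV - ?I C. L (U $ j))))"
    by (simp add: peval_universal_adjoint w_def sum_distrib_left)
  also have "\<dots> = (\<Sum>C\<in>?M. \<Sum>i\<in>?I C. g (C, i))" by (intro sum.cong refl summand)
  also have "\<dots> = sum g S" unfolding S_def using finM by (subst sum.Sigma) auto
  also have "\<dots> = 0"
  proof (rule sum_involution_cancel)
    fix p assume p: "p \<in> S"
    show "f p \<in> S" using QS Qf[OF p] .
    show "g (f p) = - g p" by (rule anti[OF p Qf[OF p]])
    have "Q (f p) p" by (rule Qsym[OF p Qf[OF p]])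
    thus "f (f p) = p" by (rule feq[OF \<open>f p \<in> S\<close>])
  qed
  finally show ?thesis .
qed

section \<open>The normal fan of a simple polytope\<close>

text \<open>The inequalities come from a minimal set of halfspaces. Minimality makes different
  halfspaces cut out different facets, so tight inequalities at a vertex can be counted as
  facets.\<close>

lemma full_dim_polytope_facet_inequalities:
  fixes P :: "'a::euclidean_space set"
  assumes P: "polytope P" and full: "aff_dim P = int DIM('a)"
  obtains H :: "'a set set" and n \<beta> where "finite H" "P = {x. \<forall>h\<in>H. \<beta> h \<le> n h \<bullet> x}"
    "bij_betw (\<lambda>h. P \<inter> {x. n h \<bullet> x = \<beta> h}) H {F. F facet_of P}"
proof -
  have aff: "affine hull P = UNIV" using full by (simp add: aff_dim_eq_full)
  obtain H where H: "finite H" "P = affine hull P \<inter> \<Inter>H"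
      "\<forall>h\<in>H. \<exists>a b. a \<noteq> 0 \<and> h = {x. a \<bullet> x \<le> b}"
      "\<forall>H'. H' \<subset> H \<longrightarrow> P \<subset> affine hull P \<inter> \<Inter>H'"
    using polytope_imp_polyhedron[OF P] unfolding polyhedron_Int_affine_minimal by blast
  from bchoice[OF H(3)] obtain a where "\<forall>h\<in>H. \<exists>b. a h \<noteq> 0 \<and> h = {x. a h \<bullet> x \<le> b}" ..
  from bchoice[OF this] obtain b where "\<forall>h\<in>H. a h \<noteq> 0 \<and> h = {x. a h \<bullet> x \<le> b h}" ..
  hence ab: "\<And>h. h \<in> H \<Longrightarrow> a h \<noteq> 0 \<and> h = {x. a h \<bullet> x \<le> b h}" by (rule bspec)
  have min: "\<And>H'. H' \<subset> H \<Longrightarrow> P \<subset> affine hull P \<inter> \<Inter>H'" by (rule H(4)[rule_format])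
  have mem: "x \<in> h \<longleftrightarrow> a h \<bullet> x \<le> b h" if "h \<in> H" for x h
    using arg_cong[OF conjunct2[OF ab[OF that]], of "\<lambda>S. x \<in> S"] by simp
  have eq: "P = {x. \<forall>h\<in>H. a h \<bullet> x \<le> b h}"
  proof -
    have "P = \<Inter>H" using H(2) aff by simp
    also have "\<dots> = {x. \<forall>h\<in>H. a h \<bullet> x \<le> b h}" using mem by auto
    finally show ?thesis .
  qed
  let ?f = "\<lambda>h. P \<inter> {x. a h \<bullet> x = b h}"
  have facets: "{F. F facet_of P} = ?f ` H"
    using facet_of_polyhedron_explicit[OF H(1,2) ab min] by blast
  have "P \<noteq> {}" using full by auto
  then obtain y where "y \<in> rel_interior P"
    using rel_interior_eq_empty[OF polytope_imp_convex[OF P]] by blast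
  hence y: "a h \<bullet> y < b h" if "h \<in> H" for h
    using rel_interior_polyhedron_explicit[OF H(1,2) ab min] that by blast
  have "inj_on ?f H"
  proof (rule inj_onI, rule ccontr)
    fix h h' assume h: "h \<in> H" "h' \<in> H" "?f h = ?f h'" "h \<noteq> h'"
    \<comment> \<open>Dropping \<open>h'\<close> enlarges the polytope, so some \<open>x\<close>
      violates the inequality of \<open>h'\<close> and no other.\<close>
    have "P \<subset> \<Inter>(H - {h'})" using min[of "H - {h'}"] h(2) aff by auto
    then obtain x where x: "x \<notin> P" and xh: "x \<in> \<Inter>(H - {h'})" by blast
    have xle: "a g \<bullet> x \<le> b g" if "g \<in> H" "g \<noteq> h'" for g
      using xh that by (simp flip: mem)
    have x': "a h' \<bullet> x > b h'"
    proof (rule ccontr)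
      assume "\<not> a h' \<bullet> x > b h'"
      hence "\<forall>g\<in>H. a g \<bullet> x \<le> b g" using xle by (metis not_less)
      thus False using x by (subst (asm) eq) simp
    qed
    \<comment> \<open>The segment from the interior point \<open>y\<close> to \<open>x\<close> leaves \<open>P\<close> through the facet of \<open>h'\<close> only.\<close>
    define t where "t = (b h' - a h' \<bullet> y) / (a h' \<bullet> x - a h' \<bullet> y)"
    define z where "z = (1 - t) *\<^sub>R y + t *\<^sub>R x"
    have t: "0 < t" "t < 1" using x' y[OF h(2)] by (auto simp: t_def field_simps)
    have "a h' \<bullet> z = a h' \<bullet> y + t * (a h' \<bullet> x - a h' \<bullet> y)"
      by (simp add: z_def inner_right_distrib algebra_simps)
    also have "\<dots> = b h'" using x' y[OF h(2)] by (simp add: t_def)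
    finally have zh': "a h' \<bullet> z = b h'" .
    have lt: "a g \<bullet> z < b g" if "g \<in> H" "g \<noteq> h'" for g
    proof -
      have "a g \<bullet> z = (1 - t) * (a g \<bullet> y) + t * (a g \<bullet> x)"
        by (simp add: z_def inner_right_distrib)
      also have "\<dots> < (1 - t) * b g + t * b g"
        using t y[OF that(1)] xle[OF that] by (intro add_less_le_mono mult_strict_left_mono mult_left_mono) auto
      finally show ?thesis by (simp add: algebra_simps)
    qed
    have "z \<in> ?f h'" using eq zh' lt by force
    moreover have "z \<notin> ?f h" using lt[OF h(1,4)] by simp
    ultimately show False using h(3) by blast
  qed
  hence "bij_betw ?f H {F. F facet_of P}" by (simp add: facets bij_betw_def)
  \<comment> \<open>The sign change turns outer normals into inner ones.\<close>
  thus ?thesis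
    using that[of H "\<lambda>h. - b h" "\<lambda>h. - a h"] H(1) eq by (simp add: inner_minus_left)
qed

text \<open>Tight inequalities survive any positive step along \<open>e\<close>, slack ones a small
  step by continuity; finitely many inequalities admit a common step.\<close>

lemma polyhedron_feasible_direction:
  fixes n :: "'h \<Rightarrow> 'a::real_inner"
  assumes "finite H" and P: "P = {x. \<forall>h\<in>H. \<beta> h \<le> n h \<bullet> x}" and "v \<in> P"
    and e: "\<And>h. h \<in> H \<Longrightarrow> n h \<bullet> v = \<beta> h \<Longrightarrow> 0 \<le> n h \<bullet> e"
  obtains \<epsilon> :: real where "\<epsilon> > 0" "v + \<epsilon> *\<^sub>R e \<in> P"
proof -
  have "\<forall>\<^sub>F \<epsilon> in at_right 0. \<beta> h \<le> n h \<bullet> (v + \<epsilon> *\<^sub>R e)" if h: "h \<in> H" for h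
  proof (cases "n h \<bullet> v = \<beta> h")
    case True
    thus ?thesis
      using e[OF h] eventually_at_right_less[of "0::real"]
      by (auto elim!: eventually_mono simp: inner_right_distrib)
  next
    case False
    hence "n h \<bullet> (v + 0 *\<^sub>R e) > \<beta> h" using \<open>v \<in> P\<close> P h by force
    moreover have "((\<lambda>\<epsilon>. n h \<bullet> (v + \<epsilon> *\<^sub>R e)) \<longlongrightarrow> n h \<bullet> (v + 0 *\<^sub>R e)) (at_right 0)"
      by (intro tendsto_intros)
    ultimately have "\<forall>\<^sub>F \<epsilon> in at_right 0. \<beta> h < n h \<bullet> (v + \<epsilon> *\<^sub>R e)"
      by (intro order_tendstoD(1))
    thus ?thesis by (rule eventually_mono) simp
  qed
  hence "\<forall>\<^sub>F \<epsilon> in at_right 0. \<forall>h\<in>H. \<beta> h \<le> n h \<bullet> (v + \<epsilon> *\<^sub>R e)"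
    using assms(1) by (simp add: eventually_ball_finite)
  hence "\<forall>\<^sub>F \<epsilon> in at_right 0. 0 < \<epsilon> \<and> v + \<epsilon> *\<^sub>R e \<in> P"
    using eventually_at_right_less[of "0::real"] by eventually_elim (simp add: P)
  hence "\<exists>\<epsilon>>0. v + \<epsilon> *\<^sub>R e \<in> P"
    using eventually_happens'[OF trivial_limit_at_right_real] by fast
  thus ?thesis using that by blast
qed

text \<open>The component of \<open>u k\<close> orthogonal to the other members is nonzero by
  independence; rescaling it gives \<open>e\<close>.\<close>

lemma indep_family_dual_vector:
  fixes u :: "'i \<Rightarrow> 'a::euclidean_space"
  assumes ind: "indep_family u I" and k: "k \<in> I"
  obtains e where "u k \<bullet> e = 1" "\<And>i. i \<in> I \<Longrightarrow> i \<noteq> k \<Longrightarrow> u i \<bullet> e = 0"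
proof -
  have inj: "inj_on u I" and indep: "independent (u ` I)" using ind by (auto simp: indep_family_def)
  have "u ` I - {u k} = u ` (I - {k})" using inj k by (auto simp: inj_on_def)
  hence notin: "u k \<notin> span (u ` (I - {k}))" using indep k unfolding dependent_def by auto
  obtain y z where yz: "y \<in> span (u ` (I - {k}))"
      "\<And>w. w \<in> span (u ` (I - {k})) \<Longrightarrow> orthogonal z w" "u k = y + z"
    using orthogonal_subspace_decomp_exists[of "u ` (I - {k})" "u k"] by metis
  have "z \<noteq> 0" using yz notin by auto
  moreover have "y \<bullet> z = 0" using yz(1,2) by (simp add: orthogonal_def inner_commute)
  ultimately have "u k \<bullet> z > 0" by (simp add: yz(3) inner_left_distrib)
  moreover have "u i \<bullet> z = 0" if "i \<in> I" "i \<noteq> k" for i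
    using yz(2)[of "u i"] that by (simp add: orthogonal_def inner_commute span_base)
  ultimately show ?thesis using that[of "inverse (u k \<bullet> z) *\<^sub>R z"] by simp
qed

section \<open>Normal cones and their faces\<close>

lemma convex_cone_inner_normal_cone: "convex_cone (inner_normal_cone P F)"
  unfolding convex_cone_iff inner_normal_cone_def
  by (auto simp: inner_left_distrib add_mono mult_left_mono)

text \<open>For \<open>f \<in> F\<close> and \<open>g \<in> G\<close> the functional
  \<open>w \<bullet> (g - f)\<close> is nonnegative on the cone of \<open>F\<close> and zero on the
  intersection. It therefore vanishes at both ends of a segment that meets the intersection
  inside.\<close>

lemma inner_normal_cone_Int_face_of:
  assumes F: "F \<noteq> {}" "F \<subseteq> P" and G: "G \<subseteq> P"
  shows "inner_normal_cone P F \<inter> inner_normal_cone P G face_of inner_normal_cone P F"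
  unfolding face_of_def
proof (intro conjI ballI impI)
  show "convex (inner_normal_cone P F \<inter> inner_normal_cone P G)"
    using convex_cone_inner_normal_cone by (intro convex_Int) (auto simp: convex_cone_def)
  fix a b x assume a: "a \<in> inner_normal_cone P F" and b: "b \<in> inner_normal_cone P F"
    and x: "x \<in> inner_normal_cone P F \<inter> inner_normal_cone P G" "x \<in> open_segment a b"
  obtain t where t: "0 < t" "t < 1" "x = (1 - t) *\<^sub>R a + t *\<^sub>R b"
    using x(2) by (auto simp: in_segment)
  obtain f where f: "f \<in> F" using F(1) by blast
  have "a \<bullet> g \<le> a \<bullet> y \<and> b \<bullet> g \<le> b \<bullet> y" if g: "g \<in> G" and y: "y \<in> P" for g y
  proof -
    have ab: "a \<bullet> f \<le> a \<bullet> g" "b \<bullet> f \<le> b \<bullet> g" "a \<bullet> f \<le> a \<bullet> y" "b \<bullet> f \<le> b \<bullet> y"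
      using a b f g y G by (auto simp: inner_normal_cone_def)
    have "x \<bullet> g \<le> x \<bullet> f" using x(1) f g F(2) by (auto simp: inner_normal_cone_def)
    hence "(1 - t) * (a \<bullet> g - a \<bullet> f) + t * (b \<bullet> g - b \<bullet> f) \<le> 0"
      by (simp add: t(3) inner_left_distrib algebra_simps)
    moreover have "0 \<le> (1 - t) * (a \<bullet> g - a \<bullet> f)" "0 \<le> t * (b \<bullet> g - b \<bullet> f)"
      using t ab by auto
    ultimately have "(1 - t) * (a \<bullet> g - a \<bullet> f) = 0" "t * (b \<bullet> g - b \<bullet> f) = 0" by linarith+
    thus ?thesis using t ab by simp
  qed
  hence "a \<in> inner_normal_cone P G" "b \<in> inner_normal_cone P G"
    by (auto simp: inner_normal_cone_def)
  thus "a \<in> inner_normal_cone P F \<inter> inner_normal_cone P G"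
    "b \<in> inner_normal_cone P F \<inter> inner_normal_cone P G" using a b by auto
qed auto

lemma argmin_face:
  fixes P :: "'a::euclidean_space set"
  assumes "polytope P" "P \<noteq> {}"
  defines "M \<equiv> \<lambda>w. {x\<in>P. \<forall>y\<in>P. w \<bullet> x \<le> w \<bullet> y}"
  shows "M w face_of P" "M w \<noteq> {}"
proof -
  have "compact P" by (rule polytope_imp_compact) fact
  moreover have "continuous_on P (\<lambda>y. w \<bullet> y)" by (intro continuous_intros)
  ultimately obtain x where x: "x \<in> P" "\<And>y. y \<in> P \<Longrightarrow> w \<bullet> x \<le> w \<bullet> y"
    using continuous_attains_inf[OF _ assms(2)] by blast
  show "M w \<noteq> {}" using x by (auto simp: M_def)
  have "M w = P \<inter> {y. w \<bullet> y = w \<bullet> x}" using x by (force simp: M_def)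
  moreover have "P \<inter> {y. w \<bullet> y = w \<bullet> x} face_of P"
    using x polytope_imp_convex[OF assms(1)] by (intro face_of_Int_supporting_hyperplane_ge) auto
  ultimately show "M w face_of P" by simp
qed

text \<open>Simplicity makes exactly \<open>DIM('a)\<close> inequalities tight at \<open>v\<close>,
  and extremality makes their normals span, so they form a basis. Moving along a dual vector shows
  that functionals minimal at \<open>v\<close> have nonnegative coordinates.\<close>

lemma simple_polytope_vertex_normals:
  fixes P :: "'a::euclidean_space set"
  assumes P: "simple_polytope P" and full: "aff_dim P = int DIM('a)"
    and H: "finite H" "P = {x. \<forall>h\<in>H. \<beta> h \<le> n h \<bullet> x}"
      "bij_betw (\<lambda>h. P \<inter> {x. n h \<bullet> x = \<beta> h}) H {F. F facet_of P}"
    and v: "v extreme_point_of P"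
  defines "A \<equiv> {h\<in>H. n h \<bullet> v = \<beta> h}"
  shows "indep_family n A" "inner_normal_cone P {v} = convex_cone hull (n ` A)"
proof -
  have vP: "v \<in> P" using v by (simp add: extreme_point_of_def)
  have finA: "finite A" using H(1) by (simp add: A_def)
  let ?f = "\<lambda>h. P \<inter> {x. n h \<bullet> x = \<beta> h}"
  have "?f ` A = {F. F facet_of P \<and> v \<in> F}"
  proof (intro set_eqI iffI)
    fix F assume "F \<in> ?f ` A"
    then obtain h where "h \<in> A" "F = ?f h" by blast
    thus "F \<in> {F. F facet_of P \<and> v \<in> F}"
      using bij_betw_apply[OF H(3), of h] vP by (auto simp: A_def)
  next
    fix F assume F: "F \<in> {F. F facet_of P \<and> v \<in> F}"
    then obtain h where "h \<in> H" "F = ?f h"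
      using bij_betw_imp_surj_on[OF H(3)] by blast
    thus "F \<in> ?f ` A" using F by (auto simp: A_def)
  qed
  moreover have inj: "inj_on ?f A"
    using bij_betw_imp_inj_on[OF H(3)] by (rule inj_on_subset) (auto simp: A_def)
  ultimately have "card A = card {F. F facet_of P \<and> v \<in> F}" using card_image[OF inj] by simp
  hence cardA: "card A = DIM('a)" using P v full by (simp add: simple_polytope_def)
  have span: "span (n ` A) = UNIV"
  proof (rule ccontr)
    \<comment> \<open>A direction orthogonal to all tight normals can be followed both ways inside
      \<open>P\<close>, which puts \<open>v\<close> inside a segment.\<close>
    assume "span (n ` A) \<noteq> UNIV"
    then obtain e where e: "e \<noteq> 0" "\<And>x. x \<in> span (n ` A) \<Longrightarrow> e \<bullet> x = 0"
      using span_not_UNIV_orthogonal by blast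
    have perp: "n h \<bullet> e = 0" if "h \<in> H" "n h \<bullet> v = \<beta> h" for h
      using e(2)[of "n h"] that by (simp add: A_def span_base inner_commute)
    obtain \<epsilon> where \<epsilon>: "\<epsilon> > 0" "v + \<epsilon> *\<^sub>R e \<in> P"
      by (rule polyhedron_feasible_direction[OF H(1,2) vP, of e]) (use perp in auto)
    obtain \<delta> where \<delta>: "\<delta> > 0" "v + \<delta> *\<^sub>R (- e) \<in> P"
      by (rule polyhedron_feasible_direction[OF H(1,2) vP, of "- e"]) (use perp in auto)
    have "v \<in> open_segment (v + \<epsilon> *\<^sub>R e) (v + \<delta> *\<^sub>R (- e))"
    proof -
      have "\<epsilon> *\<^sub>R e \<noteq> - (\<delta> *\<^sub>R e)"
        using e(1) \<epsilon>(1) \<delta>(1) by (simp add: eq_neg_iff_add_eq_0 flip: scaleR_left_distrib)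
      \<comment> \<open>The weight \<open>\<epsilon> / (\<epsilon> + \<delta>)\<close> balances the
        unequal steps.\<close>
      moreover have "(1 - \<epsilon> / (\<epsilon> + \<delta>)) *\<^sub>R (v + \<epsilon> *\<^sub>R e) + (\<epsilon> / (\<epsilon> + \<delta>)) *\<^sub>R (v + \<delta> *\<^sub>R (- e))
          = v + ((1 - \<epsilon> / (\<epsilon> + \<delta>)) * \<epsilon> - \<epsilon> / (\<epsilon> + \<delta>) * \<delta>) *\<^sub>R e"
        by (simp add: algebra_simps)
      moreover have "(1 - \<epsilon> / (\<epsilon> + \<delta>)) * \<epsilon> - \<epsilon> / (\<epsilon> + \<delta>) * \<delta> = 0"
        using \<epsilon>(1) \<delta>(1) by (simp add: field_simps)
      ultimately show ?thesis
        unfolding in_segment using \<epsilon>(1) \<delta>(1)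
        by (intro conjI exI[of _ "\<epsilon> / (\<epsilon> + \<delta>)"]) auto
    qed
    thus False using v \<epsilon>(2) \<delta>(2) by (auto simp: extreme_point_of_def)
  qed
  have "card (n ` A) \<ge> DIM('a)"
    using dim_le_card[of "UNIV :: 'a set" "n ` A"] span finA by simp
  hence card_im: "card (n ` A) = card A" using card_image_le[OF finA, of n] cardA by simp
  have "independent (n ` A)"
    using card_le_dim_spanning[of "n ` A" UNIV] span finA card_im cardA by simp
  moreover have "inj_on n A" by (rule eq_card_imp_inj_on[OF finA card_im])
  ultimately show ind: "indep_family n A" by (simp add: indep_family_def)
  show "inner_normal_cone P {v} = convex_cone hull (n ` A)"
  proof
    have "n h \<in> inner_normal_cone P {v}" if "h \<in> A" for h
      using that H(2) by (auto simp: A_def inner_normal_cone_def)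
    thus "convex_cone hull (n ` A) \<subseteq> inner_normal_cone P {v}"
      by (intro hull_minimal convex_cone_inner_normal_cone) auto
    show "inner_normal_cone P {v} \<subseteq> convex_cone hull (n ` A)"
    proof
      fix w assume w: "w \<in> inner_normal_cone P {v}"
      obtain c where c: "w = (\<Sum>h\<in>A. c h *\<^sub>R n h)"
        using indep_family_span_obtain[OF ind finA cardA] .
      have "0 \<le> c h" if h: "h \<in> A" for h
      proof -
        \<comment> \<open>The dual vector leaves the hyperplane of \<open>h\<close> and stays in the
          other tight ones. It is feasible at \<open>v\<close>, and \<open>w\<close> changes along
          it at the rate \<open>c h\<close>.\<close>
        obtain e where e: "n h \<bullet> e = 1" "\<And>g. g \<in> A \<Longrightarrow> g \<noteq> h \<Longrightarrow> n g \<bullet> e = 0"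
          using indep_family_dual_vector[OF ind h] by blast
        have "0 \<le> n g \<bullet> e" if "g \<in> H" "n g \<bullet> v = \<beta> g" for g
          using e(1) e(2)[of g] that by (cases "g = h") (auto simp: A_def)
        then obtain \<epsilon> where \<epsilon>: "\<epsilon> > 0" "v + \<epsilon> *\<^sub>R e \<in> P"
          using polyhedron_feasible_direction[OF H(1,2) vP] by metis
        have "w \<bullet> e = (\<Sum>g\<in>A. if g = h then c h else 0)"
          unfolding c inner_sum_left using e by (intro sum.cong) auto
        hence "w \<bullet> e = c h" using h finA by simp
        moreover have "w \<bullet> v \<le> w \<bullet> (v + \<epsilon> *\<^sub>R e)" using w \<epsilon>(2) by (auto simp: inner_normal_cone_def)
        ultimately show ?thesis using \<epsilon>(1) by (simp add: inner_right_distrib zero_le_mult_iff)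
      qed
      thus "w \<in> convex_cone hull (n ` A)"
        unfolding c by (intro convex_cone_hull_sum_mem finA)
    qed
  qed
qed

text \<open>Each normal cone is a face of the cone at a vertex and so has independent generators.
  Closure under faces holds because the sum of the generators of a face \<open>C\<close> is
  minimized exactly on a face of \<open>P\<close> whose normal cone is \<open>C\<close>.
  Completeness holds because every functional attains its minimum on \<open>P\<close>.\<close>

theorem normal_fan_simple_polytope:
  fixes P :: "'a::euclidean_space set"
  assumes P: "simple_polytope P" and full: "aff_dim P = int DIM('a)"
  shows "simplicial_fan (normal_fan P)" "complete_fan (normal_fan P)"
proof -
  let ?N = "inner_normal_cone P"
  let ?M = "\<lambda>w. {x\<in>P. \<forall>y\<in>P. w \<bullet> x \<le> w \<bullet> y}"
  have poly: "polytope P" using P by (simp add: simple_polytope_def)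
  have ne: "P \<noteq> {}" using full by auto
  obtain H :: "'a set set" and n \<beta> where H: "finite H" "P = {x. \<forall>h\<in>H. \<beta> h \<le> n h \<bullet> x}"
    "bij_betw (\<lambda>h. P \<inter> {x. n h \<bullet> x = \<beta> h}) H {F. F facet_of P}"
    by (rule full_dim_polytope_facet_inequalities[OF poly full])
  define A where "A v = {h\<in>H. n h \<bullet> v = \<beta> h}" for v
  have finA: "finite (A v)" for v using H(1) by (simp add: A_def)
  note vertex = simple_polytope_vertex_normals[OF P full H, folded A_def]
  have vertex_exists: "\<exists>v. v \<in> F \<and> v extreme_point_of P" if F: "F face_of P" "F \<noteq> {}" for F
  proof -
    have "polytope F" using face_of_polytope_polytope[OF poly F(1)] .
    then obtain v where "v extreme_point_of F"
      using extreme_point_exists_convex[of F] polytope_imp_compact polytope_imp_convex F(2) by blast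
    thus ?thesis using extreme_point_of_face[OF F(1)] by blast
  qed
  have face_vertex: "?N F face_of ?N {v}" if "F face_of P" "v \<in> F" for F v
  proof -
    have "?N {v} \<inter> ?N F face_of ?N {v}"
      using that face_of_imp_subset by (intro inner_normal_cone_Int_face_of) auto
    moreover have "?N {v} \<inter> ?N F = ?N F" using that by (auto simp: inner_normal_cone_def)
    ultimately show ?thesis by simp
  qed
  have generators: "\<exists>B\<subseteq>A v. C = convex_cone hull (n ` B)"
    if v: "v extreme_point_of P" and C: "C face_of ?N {v}" "C \<noteq> {}" for v C
  proof -
    have "C face_of convex_cone hull (n ` A v)" using C(1) vertex(2)[OF v] by simp
    from face_of_convex_cone_hull_obtain[OF finA this C(2)] show ?thesis by blast
  qed
  have nempty: "?N F \<noteq> {}" for F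
    using convex_cone_inner_normal_cone[of P F] by (simp add: convex_cone_def)
  have simplicial: "\<exists>S. finite S \<and> independent S \<and> C = convex_cone hull S" if C: "C \<in> normal_fan P" for C
  proof -
    obtain F where F: "F face_of P" "F \<noteq> {}" "C = ?N F" using C by (auto simp: normal_fan_def)
    then obtain v where v: "v \<in> F" "v extreme_point_of P" using vertex_exists by blast
    obtain B where B: "B \<subseteq> A v" "C = convex_cone hull (n ` B)"
      using generators[OF v(2) face_vertex[OF F(1) v(1)] nempty] F(3) by blast
    have "indep_family n B" by (rule indep_family_subset[OF vertex(1)[OF v(2)] B(1)])
    thus ?thesis using B finite_subset[OF B(1) finA] by (auto simp: indep_family_def)
  qed
  have faces: "C \<in> normal_fan P" if D: "D \<in> normal_fan P" and C: "C face_of D" "C \<noteq> {}" for C D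
  proof -
    obtain F where F: "F face_of P" "F \<noteq> {}" "D = ?N F" using D by (auto simp: normal_fan_def)
    then obtain v where v: "v \<in> F" "v extreme_point_of P" using vertex_exists by blast
    have CN: "C face_of ?N {v}"
      using C(1) F(3) face_vertex[OF F(1) v(1)] face_of_trans by blast
    obtain B where B: "B \<subseteq> A v" "C = convex_cone hull (n ` B)"
      using generators[OF v(2) CN C(2)] by blast
    have finB: "finite B" by (rule finite_subset[OF B(1) finA])
    have vP: "v \<in> P" using v(2) by (simp add: extreme_point_of_def)
    \<comment> \<open>All coefficients of \<open>w\<close> are positive, so \<open>C\<close> is
      contained in any face of the vertex cone through \<open>w\<close>, in particular in the normal
      cone of the minimizers \<open>G\<close> of \<open>w\<close>.\<close>
    define w where "w = (\<Sum>h\<in>B. 1 *\<^sub>R n h)"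
    have wC: "w \<in> C" unfolding w_def B(2) by (intro convex_cone_hull_sum_mem finB) simp
    define G where "G = ?M w"
    have G: "G face_of P" "G \<noteq> {}" using argmin_face[OF poly ne] by (simp_all add: G_def)
    have wN: "w \<in> ?N {v}" using wC CN face_of_imp_subset by blast
    hence vG: "v \<in> G" using vP by (simp add: G_def inner_normal_cone_def)
    have "w \<in> ?N G" by (auto simp: G_def inner_normal_cone_def)
    moreover have NG: "?N G face_of ?N {v}" by (rule face_vertex[OF G(1) vG])
    have "?N G \<inter> C face_of C"
      using face_of_subset[OF face_of_Int[OF NG CN]] face_of_imp_subset[OF CN] by blast
    ultimately have "?N G \<inter> C = C"
      unfolding B(2) using wC
      by (intro face_of_convex_cone_hull_eq[OF finB, where c = "\<lambda>_. 1"]) (auto simp: w_def B(2))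
    hence "C \<subseteq> ?N G" by blast
    moreover have "?N G \<subseteq> C"
    proof
      fix u assume u: "u \<in> ?N G"
      hence "u \<in> convex_cone hull (n ` A v)"
        using NG face_of_imp_subset vertex(2)[OF v(2)] by blast
      then obtain c where c: "\<And>h. h \<in> A v \<Longrightarrow> 0 \<le> c h" "u = (\<Sum>h\<in>A v. c h *\<^sub>R n h)"
        using convex_cone_hull_sum_obtain[OF finA] by metis
      have "c h = 0" if h: "h \<in> A v" "h \<notin> B" for h
      proof -
        \<comment> \<open>As \<open>h\<close> is not in \<open>B\<close>, \<open>w\<close> is
          constant along \<open>e\<close>, so a small step from \<open>v\<close> stays in
          \<open>G\<close>. Then \<open>u\<close>, minimal on \<open>G\<close>, cannot grow along
          \<open>e\<close>, which gives \<open>c h \<le> 0\<close>.\<close>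
        obtain e where e: "n h \<bullet> e = 1" "\<And>g. g \<in> A v \<Longrightarrow> g \<noteq> h \<Longrightarrow> n g \<bullet> e = 0"
          using indep_family_dual_vector[OF vertex(1)[OF v(2)] h(1)] by blast
        have "0 \<le> n g \<bullet> e" if "g \<in> H" "n g \<bullet> v = \<beta> g" for g
          using e(1) e(2)[of g] that by (cases "g = h") (auto simp: A_def)
        then obtain \<epsilon> where \<epsilon>: "\<epsilon> > 0" "v + \<epsilon> *\<^sub>R e \<in> P"
          using polyhedron_feasible_direction[OF H(1,2) vP] by metis
        have "n g \<bullet> e = 0" if "g \<in> B" for g using e(2)[of g] that B(1) h(2) by auto
        hence "w \<bullet> e = 0" by (simp add: w_def inner_sum_left)
        hence "w \<bullet> (v + \<epsilon> *\<^sub>R e) = w \<bullet> v" by (simp add: inner_right_distrib)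
        hence "v + \<epsilon> *\<^sub>R e \<in> G" using vG \<epsilon>(2) by (simp add: G_def)
        hence "u \<bullet> (v + \<epsilon> *\<^sub>R e) \<le> u \<bullet> v" using u vP by (auto simp: inner_normal_cone_def)
        moreover have "u \<bullet> e = c h"
        proof -
          have "u \<bullet> e = (\<Sum>g\<in>A v. if g = h then c h else 0)"
            unfolding c(2) inner_sum_left using e by (intro sum.cong) auto
          thus ?thesis using h finA by simp
        qed
        ultimately have "\<epsilon> * c h \<le> 0" by (simp add: inner_right_distrib)
        thus ?thesis using c(1)[OF h(1)] \<epsilon>(1) by (simp add: mult_le_0_iff)
      qed
      hence "u = (\<Sum>h\<in>B. c h *\<^sub>R n h)"
        unfolding c(2) using B(1) finA by (intro sum.mono_neutral_right) auto
      thus "u \<in> C" unfolding B(2) using convex_cone_hull_sum_mem[OF finB, of c n] c(1) B(1) by auto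
    qed
    ultimately have "C = ?N G" by blast
    thus ?thesis using G by (auto simp: normal_fan_def)
  qed
  have "finite (?N ` {F. F face_of P})" using finite_polytope_faces[OF poly] by simp
  moreover have "normal_fan P \<subseteq> ?N ` {F. F face_of P}" by (auto simp: normal_fan_def)
  ultimately have "finite (normal_fan P)" by (rule rev_finite_subset)
  moreover have "C \<inter> D face_of C" if CD: "C \<in> normal_fan P" "D \<in> normal_fan P" for C D
  proof -
    obtain F G where "F face_of P" "F \<noteq> {}" "C = ?N F" "G face_of P" "D = ?N G"
      using CD by (auto simp: normal_fan_def)
    thus ?thesis using inner_normal_cone_Int_face_of[of F P G] face_of_imp_subset by blast
  qed
  ultimately show "simplicial_fan (normal_fan P)"
    using simplicial faces unfolding simplicial_fan_def polyhedral_fan_def polyhedral_cone_def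
    by (metis Int_commute)
  have "w \<in> \<Union>(normal_fan P)" for w
  proof -
    have "?N (?M w) \<in> normal_fan P"
      using argmin_face[OF poly ne, of w] unfolding normal_fan_def by blast
    moreover have "w \<in> ?N (?M w)" by (auto simp: inner_normal_cone_def)
    ultimately show ?thesis by blast
  qed
  thus "complete_fan (normal_fan P)" by (auto simp: complete_fan_def)
qed

section \<open>The image of the ray matrix\<close>

lemma range_matrix_vector_mult:
  fixes A :: "'a::field^'n^'m"
  shows "range ((*v) A) = vec.span (columns A)"
proof
  show "range ((*v) A) \<subseteq> vec.span (columns A)"
    unfolding matrix_mult_sum
    by (intro image_subsetI vec.span_sum vec.span_scale vec.span_base) (auto simp: columns_def)
  have "columns A \<subseteq> range ((*v) A)"
  proof
    fix c assume "c \<in> columns A"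
    then obtain j where "c = column j A" by (auto simp: columns_def)
    also have "column j A = A *v axis j 1"
      by (simp add: vec_eq_iff column_def matrix_vector_mult_def axis_def if_distrib cong: if_cong)
    finally show "c \<in> range ((*v) A)" by blast
  qed
  thus "vec.span (columns A) \<subseteq> range ((*v) A)"
    by (intro vec.span_minimal vec.subspace_image) (auto simp: vec.subspace_UNIV)
qed

section \<open>Passage from real to complex scalars\<close>

abbreviation complexify :: "real^'d^'n \<Rightarrow> complex^'d^'n" where
  "complexify U \<equiv> (\<chi> i j. complex_of_real (U $ i $ j))"

text \<open>A real left inverse of \<open>U\<close>, read over the complex numbers, is still a left
  inverse.\<close>

lemma complexify_inj:
  fixes U :: "real^'d^'n"
  assumes "rank U = CARD('d)"
  shows "inj ((*v) (complexify U))"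
proof -
  obtain B where B: "B ** U = mat 1"
    using assms by (auto simp: full_rank_injective simp flip: matrix_left_invertible_injective)
  have "complexify B ** complexify U = mat 1"
    using arg_cong[OF B, of complexify]
    by (simp add: vec_eq_iff matrix_matrix_mult_def mat_def if_distrib cong: if_cong)
  thus ?thesis by (auto simp flip: matrix_left_invertible_injective)
qed

lemma dim_complex_image:
  fixes U :: "real^'d^'n"
  assumes "rank U = CARD('d)"
  shows "vec.dim (complex_image U) = CARD('d)"
proof -
  have "vec.dim (complex_image U) = vec.dim (range ((*v) (complexify U)))"
    by (simp only: complex_image_def range_matrix_vector_mult)
  also have "\<dots> = vec.dim (UNIV :: (complex^'d) set)"
    using complexify_inj[OF assms] by (intro vec.dim_image_eq) auto
  finally show ?thesis by (simp only: vec_dim_card)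
qed

lemma adjoint_vanishes_on_complex_image:
  fixes U :: "real^'d^'n"
  assumes \<Sigma>: "simplicial_fan \<Sigma>" "complete_fan \<Sigma>" "ray_matrix \<Sigma> U" and x: "x \<in> complex_image U" "x \<noteq> 0"
  shows "peval (universal_adjoint \<Sigma> U) x = 0"
proof -
  obtain z where z: "x = complexify U *v z"
    using x(1) by (auto simp: complex_image_def simp flip: range_matrix_vector_mult)
  \<comment> \<open>The bilinear pairing with \<open>z\<close>, without conjugation, so that its
    values on the rows are the coordinates of \<open>x\<close>.\<close>
  define L where "L v = (\<Sum>j\<in>UNIV. complex_of_real (v $ j) * z $ j)" for v :: "real^'d"
  have L: "linear L"
    by (rule linearI) (simp_all add: L_def distrib_right sum.distrib scaleR_sum_right, simp add: scaleR_conv_of_real mult.assoc)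
  have xL: "x = (\<chi> i. L (U $ i))" by (simp add: z L_def vec_eq_iff matrix_vector_mult_def)
  \<comment> \<open>The row of a nonzero coordinate serves as the free vector \<open>v\<close>, and
    the factor \<open>L v\<close> can be cancelled.\<close>
  obtain i where "x $ i \<noteq> 0" using x(2) by (auto simp: vec_eq_iff)
  hence "L (U $ i) \<noteq> 0" by (simp add: xL)
  thus ?thesis using linear_functional_times_adjoint[OF \<Sigma> L, of "U $ i"] by (simp add: xL)
qed

text \<open>Every representative of a point of the projectivization lies in the image, because the
  image is a complex subspace.\<close>

lemma adjoint_vanishes_on_projectivization:
  fixes U :: "real^'d^'n"
  assumes \<Sigma>: "simplicial_fan \<Sigma>" "complete_fan \<Sigma>" "ray_matrix \<Sigma> U"
    and L: "L \<in> projectivization (complex_image U)"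
  shows "vanishes_at (universal_adjoint \<Sigma> U) L"
  unfolding vanishes_at_def
proof (intro allI impI)
  fix x assume x: "x \<noteq> 0 \<and> proj_point x = L"
  obtain y where y: "y \<in> complex_image U" "L = vec.span {y}"
    using L by (auto simp: projectivization_def proj_point_def)
  have "x \<in> vec.span {y}" using x y by (auto simp: proj_point_def vec.span_base)
  also have "\<dots> \<subseteq> complex_image U"
    using y(1) unfolding complex_image_def by (intro vec.span_minimal) auto
  finally show "peval (universal_adjoint \<Sigma> U) x = 0"
    using adjoint_vanishes_on_complex_image[OF \<Sigma>] x by blast
qed

theorem theorem3p10:
  fixes \<Sigma> :: "(real^'d) set set" and U :: "real^'d^'n"
  assumes "ray_matrix \<Sigma> U"
  shows "(simplicial_fan \<Sigma> \<and> complete_fan \<Sigma> \<longrightarrow>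
           proj_linear_space (CARD('d) - 1) (projectivization (complex_image U)) \<and>
           (\<forall>L\<in>projectivization (complex_image U). vanishes_at (universal_adjoint \<Sigma> U) L)) \<and>
         (\<forall>P. simple_polytope P \<and> aff_dim P = int CARD('d) \<and> \<Sigma> = normal_fan P \<longrightarrow>
           projectivization (complex_image U) \<subseteq> adjoint_hypersurface P U)"
proof (intro conjI impI allI ballI)
  \<comment> \<open>Truncated subtraction is harmless here, since \<open>CARD('d)\<close> is
    positive.\<close>
  have "vec.dim (complex_image U) = CARD('d) - 1 + 1"
    using dim_complex_image[of U] assms by (simp add: ray_matrix_def)
  moreover have "vec.subspace (complex_image U)" by (simp add: complex_image_def)
  ultimately show "proj_linear_space (CARD('d) - 1) (projectivization (complex_image U))"
    unfolding proj_linear_space_def by blast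
next
  fix L assume "simplicial_fan \<Sigma> \<and> complete_fan \<Sigma>" "L \<in> projectivization (complex_image U)"
  thus "vanishes_at (universal_adjoint \<Sigma> U) L"
    using adjoint_vanishes_on_projectivization assms by blast
next
  fix P assume P: "simple_polytope P \<and> aff_dim P = int CARD('d) \<and> \<Sigma> = normal_fan P"
  hence fan: "simplicial_fan \<Sigma>" "complete_fan \<Sigma>"
    using normal_fan_simple_polytope[of P] by simp_all
  have "projectivization (complex_image U) \<subseteq> projectivization UNIV"
    by (auto simp: projectivization_def)
  thus "projectivization (complex_image U) \<subseteq> adjoint_hypersurface P U"
    using adjoint_vanishes_on_projectivization[OF fan assms] P
    by (auto simp: adjoint_hypersurface_def)
qed

end
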